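(* Let $a>0$ and let $p,q:\mathbb{R}\to\mathbb{R}$ be real functions with $p\in C^1(\mathbb{R})$ and $$\int_{\mathbb{R}}|q(x)|^2e^{2a|x|}dx<\infty,\quad \int_{\mathbb{R}}|p(x)|^2e^{2a|x|}dx<\infty,\quad \int_{\mathbb{R}}|p'(x)|^2e^{2a|x|}dx<\infty .$$ Let $\mathbb{D}_0(a/2)=\{\lambda\in\mathbb{C}:\lambda\neq0,\ |\lambda|<a/2\}$. Then for all $\lambda\in\mathbb{D}_0(a/2)$ and $k\in\{0,1,2\}$ there exist Jost solutions at $-\infty$, i.e. solutions $u_k(\lambda,x)$ $(x\in\mathbb{R})$ of the equation $$y'''(x)=i\lambda^3y(x)+2p(x)y'(x)+[p'(x)+iq(x)]y(x)\qquad(x\in\mathbb{R})$$ such that $u_k(\lambda,x)-e^{-i\lambda\zeta_kx}\to0$ as $x\to-\infty$, and they are given by $$u_k(\lambda,x)=e^{-i\lambda\zeta_kx}+\int_{-\infty}^x\frac{s_2(-i\lambda(x-t))}{(-i\lambda)^2}\widehat{w}_k(\lambda,t)\,dt,$$ where $\widehat{w}_k(\lambda,x)$ is a solution of the integral equation $$\widehat{w}_k(\lambda,x)=g_k(\lambda,x)+\int_{-\infty}^xK_1(\lambda,x,t)\widehat{w}_k(\lambda,t)\,dt .$$ Moreover, the functions $u_k(\lambda,x)$ and $\widehat{w}_k(\lambda,x)$ $(k=0,1,2)$ are analytic in $\lambda\in\mathbb{D}_0(a/2)$ (for each fixed $x\in\mathbb{R}$).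
   Context: Notation: $\zeta_0=1$, $\zeta_1=-\frac12+i\frac{\sqrt3}2$, $\zeta_2=-\frac12-i\frac{\sqrt3}2$ are the cube roots of $1$, and $$s_r(z)=\frac13\sum_{k=0}^2\frac1{\zeta_k^r}e^{z\zeta_k}\qquad(r=0,1,2,\ z\in\mathbb{C}).$$ The kernel and the free term of the integral equation are $$K_1(\lambda,x,t)=\frac{s_2(-i\lambda(x-t))}{(-i\lambda)^2}\,[p'(x)+iq(x)]+\frac{s_1(-i\lambda(x-t))}{-i\lambda}\,2p(x),$$ $$g_k(\lambda,x)=e^{-i\lambda\zeta_kx}\{p'(x)+iq(x)-2i\lambda\zeta_kp(x)\}.$$ Since $q$ is only assumed measurable, a solution $y$ of the third-order differential equation means a function with $y''$ locally absolutely continuous satisfying the equation almost everywhere. *)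

theory Defs
  imports "HOL-Analysis.Analysis"
begin

definition zeta :: "nat \<Rightarrow> complex" where
  "zeta k =
     (if k = 0 then 1
      else if k = 1 then Complex (- 1 / 2) (sqrt 3 / 2)
      else Complex (- 1 / 2) (- sqrt 3 / 2))"

definition s :: "nat \<Rightarrow> complex \<Rightarrow> complex" where
  "s r z = (1 / 3) * (\<Sum>k\<in>{0, 1, 2}. 1 / zeta k ^ r * exp (z * zeta k))"

definition K1 ::
  "(real \<Rightarrow> real) \<Rightarrow> (real \<Rightarrow> real) \<Rightarrow> complex \<Rightarrow> real \<Rightarrow> real \<Rightarrow> complex" where
  "K1 p q lam x t =
     s 2 (- \<i> * lam * of_real (x - t)) / (- \<i> * lam)\<^sup>2
       * (of_real (deriv p x) + \<i> * of_real (q x))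
     + s 1 (- \<i> * lam * of_real (x - t)) / (- \<i> * lam) * (2 * of_real (p x))"

definition g ::
  "(real \<Rightarrow> real) \<Rightarrow> (real \<Rightarrow> real) \<Rightarrow> nat \<Rightarrow> complex \<Rightarrow> real \<Rightarrow> complex" where
  "g p q k lam x =
     exp (- \<i> * lam * zeta k * of_real x)
       * (of_real (deriv p x) + \<i> * of_real (q x)
          - 2 * \<i> * lam * zeta k * of_real (p x))"

definition D0 :: "real \<Rightarrow> complex set" where
  "D0 r = {lam. lam \<noteq> 0 \<and> cmod lam < r}"

(* The finite families of non-overlapping subintervals are enumerated by i < n;
   degenerate intervals l i = r i are allowed and contribute nothing. *)
definition absolutely_continuous_on_interval ::
  "real \<Rightarrow> real \<Rightarrow> (real \<Rightarrow> complex) \<Rightarrow> bool" where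
  "absolutely_continuous_on_interval c d f \<longleftrightarrow>
     (\<forall>e>0. \<exists>\<delta>>0. \<forall>(n::nat) l r.
        (\<forall>i<n. c \<le> l i \<and> l i \<le> r i \<and> r i \<le> d) \<longrightarrow>
        disjoint_family_on (\<lambda>i. {l i<..<r i}) {..<n} \<longrightarrow>
        (\<Sum>i<n. r i - l i) < \<delta> \<longrightarrow>
        (\<Sum>i<n. cmod (f (r i) - f (l i))) < e)"

definition locally_absolutely_continuous :: "(real \<Rightarrow> complex) \<Rightarrow> bool" where
  "locally_absolutely_continuous f \<longleftrightarrow>
     (\<forall>c d. c \<le> d \<longrightarrow> absolutely_continuous_on_interval c d f)"

(* y1 and y2 are the first and second derivatives of y; the third derivative is only
   required to exist, and to satisfy the equation, almost everywhere. *)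
definition is_solution ::
  "(real \<Rightarrow> real) \<Rightarrow> (real \<Rightarrow> real) \<Rightarrow> complex \<Rightarrow> (real \<Rightarrow> complex) \<Rightarrow> bool" where
  "is_solution p q lam y \<longleftrightarrow>
     (\<exists>y1 y2.
        (\<forall>x. (y has_vector_derivative y1 x) (at x)) \<and>
        (\<forall>x. (y1 has_vector_derivative y2 x) (at x)) \<and>
        locally_absolutely_continuous y2 \<and>
        (AE x in lebesgue.
           (y2 has_vector_derivative
              (\<i> * lam ^ 3 * y x + 2 * of_real (p x) * y1 x
               + (of_real (deriv p x) + \<i> * of_real (q x)) * y x)) (at x)))"

definition is_Jost_solution_at_bot ::
  "(real \<Rightarrow> real) \<Rightarrow> (real \<Rightarrow> real) \<Rightarrow> nat \<Rightarrow> complex \<Rightarrow> (real \<Rightarrow> complex) \<Rightarrow> bool" where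
  "is_Jost_solution_at_bot p q k lam u \<longleftrightarrow>
     is_solution p q lam u \<and>
     ((\<lambda>x. u x - exp (- \<i> * lam * zeta k * of_real x)) \<longlongrightarrow> 0) at_bot"

(* The Lebesgue integral of a non-integrable function is 0 in the library, so
   convergence of the integrals is part of the following two representations. *)
definition solves_integral_equation ::
  "(real \<Rightarrow> real) \<Rightarrow> (real \<Rightarrow> real) \<Rightarrow> nat \<Rightarrow> complex \<Rightarrow> (real \<Rightarrow> complex) \<Rightarrow> bool" where
  "solves_integral_equation p q k lam w \<longleftrightarrow>
     (\<forall>x. set_integrable lebesgue {..x} (\<lambda>t. K1 p q lam x t * w t) \<and>
          w x = g p q k lam x + (LINT t:{..x}|lebesgue. K1 p q lam x t * w t))"

definition is_given_by ::
  "nat \<Rightarrow> complex \<Rightarrow> (real \<Rightarrow> complex) \<Rightarrow> (real \<Rightarrow> complex) \<Rightarrow> bool" where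
  "is_given_by k lam w u \<longleftrightarrow>
     (\<forall>x. set_integrable lebesgue {..x}
            (\<lambda>t. s 2 (- \<i> * lam * of_real (x - t)) / (- \<i> * lam)\<^sup>2 * w t) \<and>
          u x = exp (- \<i> * lam * zeta k * of_real x)
            + (LINT t:{..x}|lebesgue.
                 s 2 (- \<i> * lam * of_real (x - t)) / (- \<i> * lam)\<^sup>2 * w t))"

end

theory Submission
  imports Defs "HOL-Complex_Analysis.Cauchy_Integral_Formula"
begin

text \<open>
The proof is variation of constants. Put \<open>z = - \<i> lam\<close> and let \<open>e\<^sub>l(x) = exp (z \<zeta>\<^sub>l x)\<close>, \<open>l = 0, 1, 2\<close>, be
the three solutions of the free equation \<open>y''' = \<i> lam\<^sup>3 y\<close>. With \<open>P = p' + \<i> q\<close>, look for a solution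
\<open>u = \<Sum>\<^sub>l e\<^sub>l c\<^sub>l\<close> such that also \<open>u' = \<Sum>\<^sub>l z \<zeta>\<^sub>l e\<^sub>l c\<^sub>l\<close> and \<open>u'' = \<Sum>\<^sub>l (z \<zeta>\<^sub>l)\<^sup>2 e\<^sub>l c\<^sub>l\<close>. The equation then
becomes \<open>c\<^sub>l'(x) = \<zeta>\<^sub>l / (3 z\<^sup>2) e\<^sub>l(-x) w(x)\<close> with \<open>w = P u + 2 p u'\<close>, which is a linear system
\<open>c\<^sub>j' = \<Sum>\<^sub>l A\<^sub>j\<^sub>l c\<^sub>l\<close>, to be solved with \<open>c\<^sub>j = \<delta>\<^sub>j\<^sub>k\<close> at \<open>-\<infinity>\<close>.

The matrix satisfies \<open>|A(x)| \<le> M(x)\<close>, where \<open>M(x)\<close> is a constant times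
\<open>(|p'| + |q| + |p|) exp (2 |lam| |x|)\<close>. Because \<open>2 |lam| < a\<close>, the weighted square integrability of \<open>p, p', q\<close>
makes \<open>M\<close> integrable, and a single \<open>M\<close> serves all \<open>lam\<close> for which \<open>|lam|\<close> stays away from \<open>0\<close> and \<open>a / 2\<close>.
Hence the system is solved by the Dyson series of iterated integrals over \<open>(-\<infinity>, x]\<close>, whose \<open>n\<close>-th term is at
most \<open>(\<integral>M)\<^sup>n / n!\<close> (\<open>dyson_series_eq\<close>). The terms are holomorphic in \<open>lam\<close>, by differentiation under the
integral sign, and the series converges locally uniformly, so the amplitudes \<open>c\<^sub>l\<close>, and with them \<open>u\<close> and \<open>w\<close>,
are analytic in \<open>lam\<close> (\<open>holomorphic_dyson_series\<close>).

The kernel \<open>s\<^sub>2(z(x - t)) / z\<^sup>2\<close> is \<open>\<Sum>\<^sub>l \<zeta>\<^sub>l / (3 z\<^sup>2) e\<^sub>l(x) e\<^sub>l(-t)\<close>, and \<open>s\<^sub>1(z(x - t)) / z\<close> is its derivative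
in \<open>x\<close>. Substituting the integral formula for the \<open>c\<^sub>l\<close> into \<open>u\<close> and \<open>u'\<close> therefore gives the representation of
\<open>u\<close> by \<open>w\<close> and a similar one of \<open>u'\<close>; together, inserted into \<open>w = P u + 2 p u'\<close>, they are the integral equation for \<open>w\<close>.

As \<open>q\<close> is merely measurable, the \<open>c\<^sub>l\<close> are only absolutely continuous; by Lebesgue's differentiation theorem they
are differentiable almost everywhere. That \<open>u\<close> and \<open>u'\<close> are nevertheless differentiable everywhere comes from
\<open>\<Sum>\<^sub>l \<zeta>\<^sub>l = \<Sum>\<^sub>l \<zeta>\<^sub>l\<^sup>2 = 0\<close>: the contributions of the increments of the \<open>c\<^sub>l\<close> cancel to first order
(\<open>superposition_deriv\<close>).
\<close>

section \<open>Integrals over left half-lines\<close>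

abbreviation integral_upto :: "(real \<Rightarrow> 'a::{banach,second_countable_topology}) \<Rightarrow> real \<Rightarrow> 'a" where
  "integral_upto f x \<equiv> (LINT t:{..x}|lebesgue. f t)"

lemma integrable_imp_set_integrable:
  fixes f :: "real \<Rightarrow> 'a::{banach,second_countable_topology}"
  assumes "integrable lebesgue f" and "A \<in> sets lebesgue"
  shows "set_integrable lebesgue A f"
  using assms unfolding set_integrable_def by (simp add: integrable_mult_indicator)

lemma set_integral_sum:
  fixes f :: "'i \<Rightarrow> 'a \<Rightarrow> 'b::{banach,second_countable_topology}"
  assumes "\<And>l. l \<in> J \<Longrightarrow> set_integrable N A (f l)"
  shows "(LINT t:A|N. \<Sum>l\<in>J. f l t) = (\<Sum>l\<in>J. LINT t:A|N. f l t)"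
  using assms unfolding set_integrable_def set_lebesgue_integral_def scaleR_sum_right
  by (rule Bochner_Integration.integral_sum)

lemma set_integral_le_integral:
  fixes f :: "real \<Rightarrow> real"
  assumes f: "integrable lebesgue f" and "\<And>t. 0 \<le> f t" and A: "A \<in> sets lebesgue"
  shows "(LINT t:A|lebesgue. f t) \<le> integral\<^sup>L lebesgue f"
  unfolding set_lebesgue_integral_def
  by (rule integral_mono[OF integrable_imp_set_integrable[OF f A, unfolded set_integrable_def] f])
     (use assms(2) in \<open>auto simp: indicator_def\<close>)

lemma AE_lebesgue_neq: "AE t in lebesgue. t \<noteq> (x::real)"
proof (rule AE_I')
  show "{x} \<in> null_sets lebesgue" by (metis negligible_iff_null_sets negligible_sing)
qed auto

lemma tendsto_integral_upto:
  fixes f :: "real \<Rightarrow> 'a::{banach,second_countable_topology}"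
  assumes f: "integrable lebesgue f"
  shows "(integral_upto f \<longlongrightarrow> integral_upto f x) (at x within S)"
proof -
  have "(\<lambda>n. integral_upto f (X n)) \<longlonglongrightarrow> integral_upto f x" if "X \<longlonglongrightarrow> x" for X
    unfolding set_lebesgue_integral_def
  proof (rule integral_dominated_convergence[where w = "\<lambda>t. norm (f t)"])
    show "AE t in lebesgue. (\<lambda>n. indicat_real {..X n} t *\<^sub>R f t) \<longlonglongrightarrow> indicat_real {..x} t *\<^sub>R f t"
      using AE_lebesgue_neq[of x]
    proof eventually_elim
      case (elim t)
      have "\<forall>\<^sub>F n in sequentially. indicat_real {..X n} t = indicat_real {..x} t"
      proof (cases "t < x")
        case True
        then show ?thesis using order_tendstoD(1)[OF that True]
          by (auto elim!: eventually_mono simp: indicator_def)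
      next
        case False
        with elim have "x < t" by simp
        from order_tendstoD(2)[OF that this] show ?thesis using \<open>x < t\<close>
          by (auto elim!: eventually_mono simp: indicator_def)
      qed
      then have "\<forall>\<^sub>F n in sequentially. indicat_real {..x} t *\<^sub>R f t = indicat_real {..X n} t *\<^sub>R f t"
        by (rule eventually_mono) simp
      then show ?case by (rule Lim_transform_eventually[rotated]) simp
    qed
  qed (use f in \<open>auto split: split_indicator intro!: borel_measurable_scaleR borel_measurable_indicator\<close>)
  then show ?thesis
    unfolding tendsto_at_iff_sequentially comp_def by blast
qed

lemma continuous_integral_upto:
  fixes f :: "real \<Rightarrow> 'a::{banach,second_countable_topology}"
  assumes "integrable lebesgue f"
  shows "continuous_on S (integral_upto f)"
  unfolding continuous_on_def using tendsto_integral_upto[OF assms] by blast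

lemma integral_upto_tendsto_0:
  fixes f :: "real \<Rightarrow> 'a::{banach,second_countable_topology}"
  assumes f: "integrable lebesgue f"
  shows "(integral_upto f \<longlongrightarrow> 0) at_bot"
proof (rule tendsto_at_botI_sequentially)
  fix X :: "nat \<Rightarrow> real" assume X: "filterlim X at_bot sequentially"
  have "(\<lambda>n. integral_upto f (X n)) \<longlonglongrightarrow> (LINT t::real|lebesgue. (0::'a))"
    unfolding set_lebesgue_integral_def
  proof (rule integral_dominated_convergence[where w = "\<lambda>t. norm (f t)" and f = "\<lambda>_. 0"])
    show "AE t in lebesgue. (\<lambda>n. indicat_real {..X n} t *\<^sub>R f t) \<longlonglongrightarrow> 0"
    proof (rule AE_I2)
      fix t :: real
      have "\<forall>\<^sub>F n in sequentially. X n < t"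
        using X by (auto simp: filterlim_at_bot_dense)
      then have "\<forall>\<^sub>F n in sequentially. 0 = indicat_real {..X n} t *\<^sub>R f t"
        by (rule eventually_mono) (simp add: indicator_def)
      then show "(\<lambda>n. indicat_real {..X n} t *\<^sub>R f t) \<longlonglongrightarrow> 0"
        by (rule Lim_transform_eventually[rotated]) simp
    qed
  qed (use f in \<open>auto split: split_indicator intro!: borel_measurable_scaleR borel_measurable_indicator\<close>)
  then show "(\<lambda>n. integral_upto f (X n)) \<longlonglongrightarrow> 0" by simp
qed

lemma integral_upto_diff:
  fixes f :: "real \<Rightarrow> 'a::{banach,second_countable_topology}"
  assumes f: "integrable lebesgue f" and "x \<le> y"
  shows "integral_upto f y - integral_upto f x = (LINT t:{x<..y}|lebesgue. f t)"
proof -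
  have "{..y} = {..x} \<union> {x<..y}" using \<open>x \<le> y\<close> by auto
  moreover have "(LINT t:{..x} \<union> {x<..y}|lebesgue. f t) = integral_upto f x + (LINT t:{x<..y}|lebesgue. f t)"
    by (rule set_integral_Un) (auto intro!: integrable_imp_set_integrable f)
  ultimately show ?thesis by simp
qed

lemma norm_integral_upto_diff_le:
  fixes f :: "real \<Rightarrow> 'a::{banach,second_countable_topology}"
  assumes f: "integrable lebesgue f" and "x \<le> y"
  shows "norm (integral_upto f y - integral_upto f x) \<le> (LINT t:{x<..y}|lebesgue. norm (f t))"
  unfolding integral_upto_diff[OF assms]
  by (rule set_integral_norm_bound) (auto intro!: integrable_imp_set_integrable f)

lemma integral_upto_diff_HK:
  fixes f :: "real \<Rightarrow> complex"
  assumes f: "integrable lebesgue f" and "x \<le> y"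
  shows "integral_upto f y - integral_upto f x = integral {x..y} f"
proof -
  have "(LINT t:{x<..y}|lebesgue. f t) = (LINT t:{x..y}|lebesgue. f t)"
    unfolding set_lebesgue_integral_def
  proof (rule integral_cong_AE)
    show "AE t in lebesgue. indicat_real {x<..y} t *\<^sub>R f t = indicat_real {x..y} t *\<^sub>R f t"
      using AE_lebesgue_neq[of x] by eventually_elim (auto simp: indicator_def)
  qed (use f in \<open>auto intro!: borel_measurable_scaleR borel_measurable_indicator\<close>)
  then show ?thesis
    using set_lebesgue_integral_eq_integral(2)[OF integrable_imp_set_integrable[OF f, of "{x..y}"]]
      integral_upto_diff[OF assms] by simp
qed


text \<open>Lebesgue's differentiation theorem on the line. The averages over \<open>[x, x + h]\<close> converge to \<open>f x\<close> almost everywhere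
by a Vitali covering argument (\<open>integrable_ccontinuous_explicit\<close>); the averages over \<open>[x - h, x]\<close> are those of the
reflected function, so two applications give the two-sided derivative.\<close>
lemma AE_has_vector_derivative_integral_upto:
  fixes f :: "real \<Rightarrow> complex"
  assumes f: "integrable lebesgue f"
  shows "AE x in lebesgue. (integral_upto f has_vector_derivative f x) (at x)"
proof -
  have int: "f integrable_on cbox a b" for a b :: real
    using set_lebesgue_integral_eq_integral(1)[OF integrable_imp_set_integrable[OF f, of "{a..b}"]] by simp
  then have int': "(\<lambda>t. f (- t)) integrable_on cbox a b" for a b :: real
    using integrable_reflect[of f "- a" "- b"] by simp
  obtain N1 where N1: "negligible N1"
    "\<And>x e. \<lbrakk>x \<notin> N1; 0 < e\<rbrakk> \<Longrightarrow> \<exists>d>0. \<forall>h. 0 < h \<and> h < d \<longrightarrow>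
       norm (integral (cbox x (x + h *\<^sub>R One)) f /\<^sub>R h ^ DIM(real) - f x) < e"
    using integrable_ccontinuous_explicit[of f, OF int] by metis
  obtain N2 where N2: "negligible N2"
    "\<And>x e. \<lbrakk>x \<notin> N2; 0 < e\<rbrakk> \<Longrightarrow> \<exists>d>0. \<forall>h. 0 < h \<and> h < d \<longrightarrow>
       norm (integral (cbox x (x + h *\<^sub>R One)) (\<lambda>t. f (- t)) /\<^sub>R h ^ DIM(real) - f (- x)) < e"
    using integrable_ccontinuous_explicit[of "\<lambda>t. f (- t)", OF int'] by metis
  define N where "N = N1 \<union> uminus ` N2"
  have "negligible (uminus ` N2)"
    by (rule negligible_differentiable_image_negligible[OF order_refl N2(1)])
       (auto intro!: derivative_intros simp: differentiable_on_def)
  then have N: "N \<in> null_sets lebesgue"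
    using N1(1) by (simp add: N_def negligible_iff_null_sets[symmetric])
  have deriv: "(integral_upto f has_vector_derivative f x) (at x)" if "x \<notin> N" for x
    unfolding has_vector_derivative_def has_derivative_at_alt
  proof (intro conjI allI impI bounded_linear_scaleR_left)
    fix e :: real assume e: "e > 0"
    have "x \<notin> N1" "- x \<notin> N2" using that by (auto simp: N_def image_iff)
    obtain d1 where d1: "d1 > 0" "\<And>h. 0 < h \<and> h < d1 \<Longrightarrow> norm (integral {x..x + h} f /\<^sub>R h - f x) < e"
      using N1(2)[OF \<open>x \<notin> N1\<close> e] by auto
    obtain d2 where d2: "d2 > 0"
        "\<And>h. 0 < h \<and> h < d2 \<Longrightarrow> norm (integral {- x..- x + h} (\<lambda>t. f (- t)) /\<^sub>R h - f x) < e"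
      using N2(2)[OF \<open>- x \<notin> N2\<close> e] by auto
    have scale: "norm (v - h *\<^sub>R f x) \<le> e * h" if "norm (v /\<^sub>R h - f x) < e" "h > 0" for v h
    proof -
      have "v - h *\<^sub>R f x = h *\<^sub>R (v /\<^sub>R h - f x)" using \<open>h > 0\<close> by (simp add: algebra_simps)
      then have "norm (v - h *\<^sub>R f x) = h * norm (v /\<^sub>R h - f x)" using \<open>h > 0\<close>
        by (metis abs_of_pos norm_scaleR)
      also have "\<dots> \<le> h * e" using that by simp
      finally show ?thesis by (simp add: mult.commute)
    qed
    show "\<exists>d>0. \<forall>y. norm (y - x) < d \<longrightarrow>
            norm (integral_upto f y - integral_upto f x - (y - x) *\<^sub>R f x) \<le> e * norm (y - x)"
    proof (intro exI[of _ "min d1 d2"] conjI allI impI)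
      fix y assume y: "norm (y - x) < min d1 d2"
      consider "y = x" | "x < y" | "y < x" by linarith
      then show "norm (integral_upto f y - integral_upto f x - (y - x) *\<^sub>R f x) \<le> e * norm (y - x)"
      proof cases
        case 2
        then show ?thesis
          using integral_upto_diff_HK[OF f, of x y] scale[OF d1(2)[of "y - x"]] y by simp
      next
        case 3
        have "integral {- x..- y} (\<lambda>t. f (- t)) = integral {y..x} f"
          using Henstock_Kurzweil_Integration.integral_reflect[of x y f] by simp
        then have "norm (integral {y..x} f - (x - y) *\<^sub>R f x) \<le> e * (x - y)"
          using scale[OF d2(2)[of "x - y"]] y 3 by simp
        moreover have "integral_upto f y - integral_upto f x - (y - x) *\<^sub>R f x
            = - (integral {y..x} f - (x - y) *\<^sub>R f x)"
          using integral_upto_diff_HK[OF f, of y x] 3 by (simp add: algebra_simps)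
        ultimately show ?thesis using 3 by (metis norm_minus_cancel abs_of_neg diff_less_0_iff_less minus_diff_eq real_norm_def)
      qed simp
    qed (use d1 d2 in auto)
  qed
  show ?thesis
    by (rule AE_I'[OF N]) (use deriv in blast)
qed


section \<open>Absolute continuity\<close>

text \<open>Split \<open>|f|\<close> at a height \<open>n\<close>. The part above \<open>n\<close> has integral less than \<open>e / 2\<close> for some \<open>n\<close>,
by dominated convergence, and the part below contributes at most \<open>n\<close> times the total length of the intervals.\<close>
lemma absolutely_continuous_integral_upto:
  fixes f :: "real \<Rightarrow> complex"
  assumes f: "integrable lebesgue f"
  shows "absolutely_continuous_on_interval c d (integral_upto f)"
  unfolding absolutely_continuous_on_interval_def
proof (intro allI impI)
  fix e :: real assume e: "e > 0"
  define T where "T n t = norm (f t) - min (norm (f t)) (real n)" for n t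
  have T_int: "integrable lebesgue (T n)" for n
    unfolding T_def by (rule Bochner_Integration.integrable_bound[OF integrable_norm[OF f]]) (use f in auto)
  have T_nonneg: "0 \<le> T n t" for n t by (simp add: T_def)
  have "(\<lambda>n. integral\<^sup>L lebesgue (T n)) \<longlonglongrightarrow> (LINT t::real|lebesgue. (0::real))"
  proof (rule integral_dominated_convergence[where w = "\<lambda>t. norm (f t)"])
    show "AE t in lebesgue. (\<lambda>n. T n t) \<longlonglongrightarrow> 0"
    proof (rule AE_I2)
      fix t :: real
      have "\<forall>\<^sub>F n in sequentially. norm (f t) \<le> real n"
        by (rule eventually_sequentiallyI[of "nat \<lceil>norm (f t)\<rceil>"]) linarith
      then have "\<forall>\<^sub>F n in sequentially. 0 = T n t"
        by (rule eventually_mono) (simp add: T_def)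
      then show "(\<lambda>n. T n t) \<longlonglongrightarrow> 0" by (rule Lim_transform_eventually[rotated]) simp
    qed
    show "AE t in lebesgue. norm (T n t) \<le> norm (f t)" for n
      by (simp add: T_def)
  qed (use f T_int in auto)
  then have "(\<lambda>n. integral\<^sup>L lebesgue (T n)) \<longlonglongrightarrow> 0" by simp
  then obtain n where n: "integral\<^sup>L lebesgue (T n) < e / 2"
    using order_tendstoD(2)[of _ 0 sequentially "e / 2"] e by (metis eventually_sequentially half_gt_zero order_refl)
  define \<delta> where "\<delta> = e / (2 * (real n + 1))"
  show "\<exists>\<delta>>0. \<forall>(m::nat) l r. (\<forall>i<m. c \<le> l i \<and> l i \<le> r i \<and> r i \<le> d) \<longrightarrow>
        disjoint_family_on (\<lambda>i. {l i<..<r i}) {..<m} \<longrightarrow> (\<Sum>i<m. r i - l i) < \<delta> \<longrightarrow>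
        (\<Sum>i<m. cmod (integral_upto f (r i) - integral_upto f (l i))) < e"
  proof (intro exI[of _ \<delta>] conjI allI impI)
    show "\<delta> > 0" using e by (simp add: \<delta>_def)
    fix m :: nat and l r :: "nat \<Rightarrow> real"
    assume lr: "\<forall>i<m. c \<le> l i \<and> l i \<le> r i \<and> r i \<le> d"
      and disj: "disjoint_family_on (\<lambda>i. {l i<..<r i}) {..<m}"
      and small: "(\<Sum>i<m. r i - l i) < \<delta>"
    have each: "cmod (integral_upto f (r i) - integral_upto f (l i))
        \<le> (LINT t:{l i<..<r i}|lebesgue. T n t) + real n * (r i - l i)" if "i < m" for i
    proof -
      have le: "l i \<le> r i" using lr that by auto
      have const_int: "set_integrable lebesgue {l i<..r i} (\<lambda>t. real n)"
        unfolding set_integrable_def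
        by (intro integrable_scaleR_left integrable_real_indicator) (use le in auto)
      have "cmod (integral_upto f (r i) - integral_upto f (l i)) \<le> (LINT t:{l i<..r i}|lebesgue. norm (f t))"
        by (rule norm_integral_upto_diff_le[OF f le])
      also have "\<dots> \<le> (LINT t:{l i<..r i}|lebesgue. T n t + real n)"
      proof (rule set_integral_mono)
        show "set_integrable lebesgue {l i<..r i} (\<lambda>t. norm (f t))"
          by (rule integrable_imp_set_integrable) (use f in auto)
        show "set_integrable lebesgue {l i<..r i} (\<lambda>t. T n t + real n)"
          by (intro set_integral_add(1) const_int integrable_imp_set_integrable T_int) auto
      qed (auto simp: T_def)
      also have "\<dots> = (LINT t:{l i<..r i}|lebesgue. T n t) + real n * (r i - l i)"
        using le by (subst set_integral_add(2)[OF integrable_imp_set_integrable[OF T_int] const_int]) (auto simp: set_lebesgue_integral_def)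
      also have "(LINT t:{l i<..r i}|lebesgue. T n t) = (LINT t:{l i<..<r i}|lebesgue. T n t)"
        unfolding set_lebesgue_integral_def
      proof (rule integral_cong_AE)
        show "AE t in lebesgue. indicat_real {l i<..r i} t *\<^sub>R T n t = indicat_real {l i<..<r i} t *\<^sub>R T n t"
          using AE_lebesgue_neq[of "r i"] by eventually_elim (auto simp: indicator_def)
      qed (use T_int in \<open>auto intro!: borel_measurable_times borel_measurable_indicator\<close>)
      finally show ?thesis .
    qed
    have "(\<Sum>i<m. LINT t:{l i<..<r i}|lebesgue. T n t) = (LINT t:(\<Union>i<m. {l i<..<r i})|lebesgue. T n t)"
      by (rule set_integral_finite_Union[symmetric]) (use disj in \<open>auto intro!: integrable_imp_set_integrable T_int\<close>)
    also have "\<dots> \<le> integral\<^sup>L lebesgue (T n)"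
      by (rule set_integral_le_integral) (auto intro!: T_int T_nonneg)
    finally have T_sum: "(\<Sum>i<m. LINT t:{l i<..<r i}|lebesgue. T n t) < e / 2" using n by linarith
    have "real n * \<delta> \<le> e / 2"
      using e by (simp add: \<delta>_def field_simps)
    then have lin: "real n * (\<Sum>i<m. r i - l i) \<le> e / 2"
      using mult_left_mono[of "\<Sum>i<m. r i - l i" \<delta> "real n"] small by linarith
    have "(\<Sum>i<m. cmod (integral_upto f (r i) - integral_upto f (l i)))
        \<le> (\<Sum>i<m. (LINT t:{l i<..<r i}|lebesgue. T n t) + real n * (r i - l i))"
      by (rule sum_mono) (use each in auto)
    also have "\<dots> = (\<Sum>i<m. LINT t:{l i<..<r i}|lebesgue. T n t) + real n * (\<Sum>i<m. r i - l i)"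
      by (simp add: sum.distrib sum_distrib_left)
    also have "\<dots> < e" using T_sum lin by linarith
    finally show "(\<Sum>i<m. cmod (integral_upto f (r i) - integral_upto f (l i))) < e" .
  qed
qed

lemma absolutely_continuous_Lipschitz:
  assumes le: "\<And>x y. c \<le> x \<Longrightarrow> x \<le> y \<Longrightarrow> y \<le> d \<Longrightarrow> cmod (f y - f x) \<le> L * (y - x)"
  shows "absolutely_continuous_on_interval c d f"
  unfolding absolutely_continuous_on_interval_def
proof (intro allI impI)
  fix e :: real assume e: "e > 0"
  define K where "K = \<bar>L\<bar> + 1"
  have K: "K > 0" "L \<le> K" by (auto simp: K_def)
  show "\<exists>\<delta>>0. \<forall>(n::nat) l r. (\<forall>i<n. c \<le> l i \<and> l i \<le> r i \<and> r i \<le> d) \<longrightarrow>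
      disjoint_family_on (\<lambda>i. {l i<..<r i}) {..<n} \<longrightarrow> (\<Sum>i<n. r i - l i) < \<delta> \<longrightarrow>
      (\<Sum>i<n. cmod (f (r i) - f (l i))) < e"
  proof (intro exI[of _ "e / K"] conjI allI impI)
    fix n :: nat and l r :: "nat \<Rightarrow> real"
    assume lr: "\<forall>i<n. c \<le> l i \<and> l i \<le> r i \<and> r i \<le> d" and small: "(\<Sum>i<n. r i - l i) < e / K"
    have "(\<Sum>i<n. cmod (f (r i) - f (l i))) \<le> (\<Sum>i<n. K * (r i - l i))"
    proof (rule sum_mono)
      fix i assume i: "i \<in> {..<n}"
      then have "cmod (f (r i) - f (l i)) \<le> L * (r i - l i)" using lr by (intro le) auto
      also have "\<dots> \<le> K * (r i - l i)" using lr i K by (intro mult_right_mono) auto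
      finally show "cmod (f (r i) - f (l i)) \<le> K * (r i - l i)" .
    qed
    also have "\<dots> = K * (\<Sum>i<n. r i - l i)" by (rule sum_distrib_left[symmetric])
    also have "\<dots> < e" using small K by (simp add: pos_less_divide_eq mult.commute)
    finally show "(\<Sum>i<n. cmod (f (r i) - f (l i))) < e" .
  qed (use e K in auto)
qed

lemma absolutely_continuous_add:
  assumes f: "absolutely_continuous_on_interval c d f" and h: "absolutely_continuous_on_interval c d h"
  shows "absolutely_continuous_on_interval c d (\<lambda>x. f x + h x)"
  unfolding absolutely_continuous_on_interval_def
proof (intro allI impI)
  fix e :: real assume "e > 0"
  then have e: "e / 2 > 0" by simp
  obtain \<delta>1 where \<delta>1: "\<delta>1 > 0" "\<And>(n::nat) l r. (\<forall>i<n. c \<le> l i \<and> l i \<le> r i \<and> r i \<le> d) \<Longrightarrow>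
      disjoint_family_on (\<lambda>i. {l i<..<r i}) {..<n} \<Longrightarrow> (\<Sum>i<n. r i - l i) < \<delta>1 \<Longrightarrow>
      (\<Sum>i<n. cmod (f (r i) - f (l i))) < e / 2"
    using f[unfolded absolutely_continuous_on_interval_def, rule_format, OF e] by blast
  obtain \<delta>2 where \<delta>2: "\<delta>2 > 0" "\<And>(n::nat) l r. (\<forall>i<n. c \<le> l i \<and> l i \<le> r i \<and> r i \<le> d) \<Longrightarrow>
      disjoint_family_on (\<lambda>i. {l i<..<r i}) {..<n} \<Longrightarrow> (\<Sum>i<n. r i - l i) < \<delta>2 \<Longrightarrow>
      (\<Sum>i<n. cmod (h (r i) - h (l i))) < e / 2"
    using h[unfolded absolutely_continuous_on_interval_def, rule_format, OF e] by blast
  show "\<exists>\<delta>>0. \<forall>(n::nat) l r. (\<forall>i<n. c \<le> l i \<and> l i \<le> r i \<and> r i \<le> d) \<longrightarrow>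
      disjoint_family_on (\<lambda>i. {l i<..<r i}) {..<n} \<longrightarrow> (\<Sum>i<n. r i - l i) < \<delta> \<longrightarrow>
      (\<Sum>i<n. cmod (f (r i) + h (r i) - (f (l i) + h (l i)))) < e"
  proof (intro exI[of _ "min \<delta>1 \<delta>2"] conjI allI impI)
    fix n :: nat and l r :: "nat \<Rightarrow> real"
    assume lr: "\<forall>i<n. c \<le> l i \<and> l i \<le> r i \<and> r i \<le> d"
        "disjoint_family_on (\<lambda>i. {l i<..<r i}) {..<n}" "(\<Sum>i<n. r i - l i) < min \<delta>1 \<delta>2"
    have "(\<Sum>i<n. cmod (f (r i) + h (r i) - (f (l i) + h (l i))))
        \<le> (\<Sum>i<n. cmod (f (r i) - f (l i)) + cmod (h (r i) - h (l i)))"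
      by (rule sum_mono) (metis add_diff_add norm_triangle_ineq)
    also have "\<dots> < e" using \<delta>1(2)[OF lr(1,2)] \<delta>2(2)[OF lr(1,2)] lr(3) by (simp add: sum.distrib)
    finally show "(\<Sum>i<n. cmod (f (r i) + h (r i) - (f (l i) + h (l i)))) < e" .
  qed (use \<delta>1 \<delta>2 in auto)
qed

lemma absolutely_continuous_mult:
  assumes f: "absolutely_continuous_on_interval c d f" and h: "absolutely_continuous_on_interval c d h"
    and f_cont: "continuous_on {c..d} f" and h_cont: "continuous_on {c..d} h"
  shows "absolutely_continuous_on_interval c d (\<lambda>x. f x * h x)"
  unfolding absolutely_continuous_on_interval_def
proof (intro allI impI)
  fix e :: real assume "e > 0"
  have bdd: "\<exists>B>0. \<forall>x\<in>{c..d}. cmod (\<phi> x) \<le> B" if "continuous_on {c..d} \<phi>" for \<phi> :: "real \<Rightarrow> complex"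
    using compact_imp_bounded[OF compact_continuous_image[OF that compact_Icc]]
    by (force simp: bounded_pos)
  obtain F where F: "F > 0" "\<And>x. x \<in> {c..d} \<Longrightarrow> cmod (f x) \<le> F" using bdd[OF f_cont] by blast
  obtain G where G: "G > 0" "\<And>x. x \<in> {c..d} \<Longrightarrow> cmod (h x) \<le> G" using bdd[OF h_cont] by blast
  have e: "e / (2 * G) > 0" "e / (2 * F) > 0" using \<open>e > 0\<close> F G by auto
  obtain \<delta>1 where \<delta>1: "\<delta>1 > 0" "\<And>(n::nat) l r. (\<forall>i<n. c \<le> l i \<and> l i \<le> r i \<and> r i \<le> d) \<Longrightarrow>
      disjoint_family_on (\<lambda>i. {l i<..<r i}) {..<n} \<Longrightarrow> (\<Sum>i<n. r i - l i) < \<delta>1 \<Longrightarrow>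
      (\<Sum>i<n. cmod (f (r i) - f (l i))) < e / (2 * G)"
    using f[unfolded absolutely_continuous_on_interval_def, rule_format, OF e(1)] by blast
  obtain \<delta>2 where \<delta>2: "\<delta>2 > 0" "\<And>(n::nat) l r. (\<forall>i<n. c \<le> l i \<and> l i \<le> r i \<and> r i \<le> d) \<Longrightarrow>
      disjoint_family_on (\<lambda>i. {l i<..<r i}) {..<n} \<Longrightarrow> (\<Sum>i<n. r i - l i) < \<delta>2 \<Longrightarrow>
      (\<Sum>i<n. cmod (h (r i) - h (l i))) < e / (2 * F)"
    using h[unfolded absolutely_continuous_on_interval_def, rule_format, OF e(2)] by blast
  show "\<exists>\<delta>>0. \<forall>(n::nat) l r. (\<forall>i<n. c \<le> l i \<and> l i \<le> r i \<and> r i \<le> d) \<longrightarrow>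
      disjoint_family_on (\<lambda>i. {l i<..<r i}) {..<n} \<longrightarrow> (\<Sum>i<n. r i - l i) < \<delta> \<longrightarrow>
      (\<Sum>i<n. cmod (f (r i) * h (r i) - f (l i) * h (l i))) < e"
  proof (intro exI[of _ "min \<delta>1 \<delta>2"] conjI allI impI)
    fix n :: nat and l r :: "nat \<Rightarrow> real"
    assume lr: "\<forall>i<n. c \<le> l i \<and> l i \<le> r i \<and> r i \<le> d"
        "disjoint_family_on (\<lambda>i. {l i<..<r i}) {..<n}" "(\<Sum>i<n. r i - l i) < min \<delta>1 \<delta>2"
    have "(\<Sum>i<n. cmod (f (r i) * h (r i) - f (l i) * h (l i)))
        \<le> (\<Sum>i<n. cmod (f (r i) - f (l i)) * G + F * cmod (h (r i) - h (l i)))"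
    proof (rule sum_mono)
      fix i assume "i \<in> {..<n}"
      then have mem: "l i \<in> {c..d}" "r i \<in> {c..d}" using lr(1) by force+
      have "f (r i) * h (r i) - f (l i) * h (l i) = (f (r i) - f (l i)) * h (r i) + f (l i) * (h (r i) - h (l i))"
        by (simp add: algebra_simps)
      also have "cmod \<dots> \<le> cmod (f (r i) - f (l i)) * cmod (h (r i)) + cmod (f (l i)) * cmod (h (r i) - h (l i))"
        by (metis norm_mult norm_triangle_ineq)
      also have "\<dots> \<le> cmod (f (r i) - f (l i)) * G + F * cmod (h (r i) - h (l i))"
        using F(2) G(2) mem by (intro add_mono mult_left_mono mult_right_mono) auto
      finally show "cmod (f (r i) * h (r i) - f (l i) * h (l i))
          \<le> cmod (f (r i) - f (l i)) * G + F * cmod (h (r i) - h (l i))" .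
    qed
    also have "\<dots> = (\<Sum>i<n. cmod (f (r i) - f (l i))) * G + F * (\<Sum>i<n. cmod (h (r i) - h (l i)))"
      by (simp add: sum.distrib sum_distrib_left sum_distrib_right)
    also have "\<dots> < e / (2 * G) * G + F * (e / (2 * F))"
      using \<delta>1(2)[OF lr(1,2)] \<delta>2(2)[OF lr(1,2)] lr(3) F G
      by (intro add_strict_mono mult_strict_left_mono mult_strict_right_mono) auto
    also have "\<dots> = e" using F G by simp
    finally show "(\<Sum>i<n. cmod (f (r i) * h (r i) - f (l i) * h (l i))) < e" .
  qed (use \<delta>1 \<delta>2 in auto)
qed

lemma absolutely_continuous_sum:
  assumes "\<And>l. l \<in> J \<Longrightarrow> absolutely_continuous_on_interval c d (f l)"
  shows "absolutely_continuous_on_interval c d (\<lambda>x. \<Sum>l\<in>J. f l x)"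
  using assms
proof (induction J rule: infinite_finite_induct)
  case (insert l J)
  then show ?case by (auto intro: absolutely_continuous_add)
qed (auto intro!: absolutely_continuous_Lipschitz[of _ _ _ 0])

lemma absolutely_continuous_C1:
  fixes f :: "real \<Rightarrow> complex"
  assumes deriv: "\<And>x. (f has_vector_derivative f' x) (at x)" and cont: "continuous_on {c..d} f'"
  shows "absolutely_continuous_on_interval c d f"
proof -
  obtain B where B: "\<And>x. x \<in> {c..d} \<Longrightarrow> cmod (f' x) \<le> B"
    using compact_imp_bounded[OF compact_continuous_image[OF cont compact_Icc]]
    by (force simp: bounded_iff)
  show ?thesis
  proof (rule absolutely_continuous_Lipschitz)
    fix x y assume xy: "c \<le> x" "x \<le> y" "y \<le> d"
    have "norm (f y - f x) \<le> B * norm (y - x)"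
    proof (rule differentiable_bound[of "{x..y}" f "\<lambda>x h. h *\<^sub>R f' x"])
      show "(f has_derivative (\<lambda>h. h *\<^sub>R f' t)) (at t within {x..y})" for t
        using has_vector_derivative_at_within[OF deriv] by (simp add: has_vector_derivative_def)
      show "onorm (\<lambda>h. h *\<^sub>R f' t) \<le> B" if "t \<in> {x..y}" for t
      proof (rule onorm_bound)
        have t: "cmod (f' t) \<le> B" using B that xy by auto
        then show "0 \<le> B" using norm_ge_zero order_trans by blast
        show "norm (h *\<^sub>R f' t) \<le> B * norm h" for h
          using mult_left_mono[OF t, of "\<bar>h\<bar>"] by (simp add: mult.commute)
      qed
    qed (use xy in auto)
    then show "cmod (f y - f x) \<le> B * (y - x)" using xy by simp
  qed
qed


section \<open>Powers of an integral over a half-line\<close>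

lemma sigma_finite_lebesgue: "sigma_finite_measure (lebesgue :: 'a::euclidean_space measure)"
proof
  obtain A :: "'a set set" where A: "countable A" "A \<subseteq> sets lborel" "\<Union>A = space lborel"
    "\<forall>a\<in>A. emeasure lborel a \<noteq> \<infinity>"
    using lborel.sigma_finite_countable by blast
  then show "\<exists>A::'a set set. countable A \<and> A \<subseteq> sets lebesgue \<and> \<Union>A = space lebesgue \<and>
      (\<forall>a\<in>A. emeasure lebesgue a \<noteq> \<infinity>)"
    by (intro exI[of _ A]) auto
qed

interpretation lebesgue: sigma_finite_measure "lebesgue :: real measure"
  by (rule sigma_finite_lebesgue)
interpretation lebesgue_pair: pair_sigma_finite "lebesgue :: real measure" "lebesgue :: real measure" ..

text \<open>Integration by parts for the primitives of two integrable functions. By Fubini the left-hand side is an integral of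
\<open>f(r) g(t)\<close> over a quadrant; the diagonal cuts it into the two regions that the right-hand side integrates over.\<close>
lemma integral_upto_mult:
  fixes f g :: "real \<Rightarrow> real"
  assumes f: "integrable lebesgue f" and g: "integrable lebesgue g"
  shows "integral_upto f x * integral_upto g x
    = integral_upto (\<lambda>t. f t * integral_upto g t) x + integral_upto (\<lambda>t. g t * integral_upto f t) x"
proof -
  let ?D = "lebesgue \<Otimes>\<^sub>M lebesgue :: (real \<times> real) measure"
  define F where "F t = indicat_real {..x} t * f t" for t
  define G where "G t = indicat_real {..x} t * g t" for t
  have F: "integrable lebesgue F" and G: "integrable lebesgue G"
    unfolding F_def G_def using integrable_imp_set_integrable[OF f, of "{..x}"] integrable_imp_set_integrable[OF g, of "{..x}"]
    by (auto simp: set_integrable_def)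
  have Fm[measurable]: "F \<in> borel_measurable lebesgue" and Gm[measurable]: "G \<in> borel_measurable lebesgue"
    using F G by auto
  have FG_meas: "(\<lambda>(r, t). F r * G t) \<in> borel_measurable ?D"
    by measurable
  have FG: "integrable ?D (\<lambda>(r, t). F r * G t)"
    by (rule lebesgue_pair.Fubini_integrable)
       (use F G FG_meas in \<open>auto simp: abs_mult intro!: integrable_mult_left\<close>)
  have id: "(\<lambda>t::real. t) \<in> borel_measurable lebesgue"
    by (rule measurable_completion) simp
  have proj: "fst \<in> borel_measurable ?D" "snd \<in> borel_measurable ?D"
    using measurable_compose[OF measurable_fst id] measurable_compose[OF measurable_snd id]
    by (auto simp: comp_def)
  define L where "L = {z. snd z \<le> (fst z :: real)}"
  have L: "L \<in> sets ?D"
    using borel_measurable_le[OF proj(2,1)] by (auto simp: L_def space_pair_measure)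
  have int_L: "integrable ?D (\<lambda>z. indicat_real L z * (case z of (r, t) \<Rightarrow> F r * G t))"
    using integrable_mult_indicator[OF L FG] by simp
  have int_L': "integrable ?D (\<lambda>z. indicat_real (- L) z * (case z of (r, t) \<Rightarrow> F r * G t))"
    using integrable_mult_indicator[OF _ FG, of "- L"] sets.compl_sets[OF L]
    by (simp add: Compl_eq_Diff_UNIV space_pair_measure)
  have below: "(LINT t|lebesgue. indicat_real L (r, t) * (F r * G t))
      = indicat_real {..x} r * (f r * integral_upto g r)" for r
  proof (cases "r \<le> x")
    case True
    have "(LINT t|lebesgue. indicat_real L (r, t) * (F r * G t))
        = (LINT t|lebesgue. F r * (indicat_real {..r} t * g t))"
      by (rule Bochner_Integration.integral_cong) (use True in \<open>auto simp: L_def G_def indicator_def\<close>)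
    with True show ?thesis by (simp add: F_def set_lebesgue_integral_def)
  qed (simp add: F_def)
  have above: "(LINT r|lebesgue. indicat_real (- L) (r, t) * (F r * G t))
      = indicat_real {..x} t * (g t * integral_upto f t)" for t
  proof (cases "t \<le> x")
    case True
    have "(LINT r|lebesgue. indicat_real (- L) (r, t) * (F r * G t))
        = (LINT r|lebesgue. G t * (indicat_real {..t} r * f r))"
    proof (rule integral_cong_AE)
      show "AE r in lebesgue. indicat_real (- L) (r, t) * (F r * G t) = G t * (indicat_real {..t} r * f r)"
        using AE_lebesgue_neq[of t]
        by eventually_elim (use True in \<open>auto simp: L_def F_def indicator_def\<close>)
      have "(\<lambda>r. indicat_real (- L) (r, t) * (F r * G t)) = (\<lambda>r. indicat_real {..<t} r * (F r * G t))"
        by (auto simp: L_def indicator_def)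
      then show "(\<lambda>r. indicat_real (- L) (r, t) * (F r * G t)) \<in> borel_measurable lebesgue"
        by (auto intro!: borel_measurable_times borel_measurable_indicator Fm)
      show "(\<lambda>r. G t * (indicat_real {..t} r * f r)) \<in> borel_measurable lebesgue"
        using f by (auto intro!: borel_measurable_times borel_measurable_indicator)
    qed
    with True show ?thesis by (simp add: G_def set_lebesgue_integral_def)
  qed (simp add: G_def)
  have "integral_upto f x * integral_upto g x = (LINT r|lebesgue. LINT t|lebesgue. F r * G t)"
    by (simp add: F_def G_def set_lebesgue_integral_def)
  also have "\<dots> = (LINT z|?D. (case z of (r, t) \<Rightarrow> F r * G t))"
    using lebesgue_pair.integral_fst'[OF FG] by simp
  also have "\<dots> = (LINT z|?D. indicat_real L z * (case z of (r, t) \<Rightarrow> F r * G t)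
      + indicat_real (- L) z * (case z of (r, t) \<Rightarrow> F r * G t))"
    by (rule Bochner_Integration.integral_cong) (auto simp: indicator_def)
  also have "\<dots> = (LINT z|?D. indicat_real L z * (case z of (r, t) \<Rightarrow> F r * G t))
      + (LINT z|?D. indicat_real (- L) z * (case z of (r, t) \<Rightarrow> F r * G t))"
    by (rule Bochner_Integration.integral_add[OF int_L int_L'])
  also have "(LINT z|?D. indicat_real L z * (case z of (r, t) \<Rightarrow> F r * G t))
      = (LINT r|lebesgue. LINT t|lebesgue. indicat_real L (r, t) * (F r * G t))"
    using lebesgue_pair.integral_fst'[OF int_L] by simp
  also have "\<dots> = integral_upto (\<lambda>t. f t * integral_upto g t) x"
    unfolding below by (simp add: set_lebesgue_integral_def)
  also have "(LINT z|?D. indicat_real (- L) z * (case z of (r, t) \<Rightarrow> F r * G t))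
      = (LINT t|lebesgue. LINT r|lebesgue. indicat_real (- L) (r, t) * (F r * G t))"
    using lebesgue_pair.integral_snd[of "\<lambda>r t. indicat_real (- L) (r, t) * (F r * G t)"] int_L'
    by (simp add: case_prod_unfold)
  also have "\<dots> = integral_upto (\<lambda>t. g t * integral_upto f t) x"
    unfolding above by (simp add: set_lebesgue_integral_def)
  finally show ?thesis .
qed

lemma integrable_mult_integral_upto_power:
  fixes M :: "real \<Rightarrow> real"
  assumes M: "integrable lebesgue M" and nonneg: "\<And>t. 0 \<le> M t"
  shows "integrable lebesgue (\<lambda>t. M t * integral_upto M t ^ n)"
proof (rule Bochner_Integration.integrable_bound)
  show "integrable lebesgue (\<lambda>t. M t * integral\<^sup>L lebesgue M ^ n)" using M by simp
  have "integral_upto M \<in> borel_measurable borel"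
    by (rule borel_measurable_continuous_onI[OF continuous_integral_upto[OF M]])
  then show "(\<lambda>t. M t * integral_upto M t ^ n) \<in> borel_measurable lebesgue"
    using M by (intro borel_measurable_times borel_measurable_power) (auto intro: measurable_completion)
  show "AE t in lebesgue. norm (M t * integral_upto M t ^ n) \<le> norm (M t * integral\<^sup>L lebesgue M ^ n)"
  proof (rule AE_I2)
    fix t :: real
    have 0: "0 \<le> integral_upto M t"
      unfolding set_lebesgue_integral_def by (rule integral_nonneg_AE) (use nonneg in auto)
    moreover have "integral_upto M t \<le> integral\<^sup>L lebesgue M"
      by (rule set_integral_le_integral[OF M nonneg]) simp
    ultimately have "integral_upto M t ^ n \<le> integral\<^sup>L lebesgue M ^ n" by (rule power_mono[rotated])
    with 0 show "norm (M t * integral_upto M t ^ n) \<le> norm (M t * integral\<^sup>L lebesgue M ^ n)"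
      using nonneg[of t] by (auto simp: abs_mult power_abs[symmetric] intro!: mult_left_mono)
  qed
qed

text \<open>For a continuous \<open>M\<close> this is the chain rule for the powers of the primitive \<open>E\<close> of \<open>M\<close>. For integrable \<open>M\<close> it follows
by induction from integration by parts. It turns the iterated integrals of \<open>M\<close> into \<open>E\<^sup>n / n!\<close>.\<close>
lemma integral_upto_power:
  fixes M :: "real \<Rightarrow> real"
  assumes M: "integrable lebesgue M" and nonneg: "\<And>t. 0 \<le> M t"
  shows "integral_upto M x ^ Suc n = real (Suc n) * integral_upto (\<lambda>t. M t * integral_upto M t ^ n) x"
proof (induction n arbitrary: x)
  case (Suc n)
  let ?E = "integral_upto M"
  let ?g = "\<lambda>t. real (Suc n) * (M t * ?E t ^ n)"
  have int: "integrable lebesgue (\<lambda>t. M t * ?E t ^ k)" for k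
    by (rule integrable_mult_integral_upto_power[OF M nonneg])
  have E: "?E y ^ Suc n = integral_upto ?g y" for y
    unfolding Suc.IH[of y] by simp
  have "?E x ^ Suc (Suc n) = ?E x * integral_upto ?g x" using E[of x] by simp
  also have "\<dots> = integral_upto (\<lambda>t. M t * integral_upto ?g t) x + integral_upto (\<lambda>t. ?g t * ?E t) x"
    by (rule integral_upto_mult) (use M int in auto)
  also have "\<dots> = integral_upto (\<lambda>t. M t * ?E t ^ Suc n) x + real (Suc n) * integral_upto (\<lambda>t. M t * ?E t ^ Suc n) x"
    unfolding E[symmetric] by (simp add: mult_ac flip: set_integral_mult_right)
  also have "\<dots> = real (Suc (Suc n)) * integral_upto (\<lambda>t. M t * ?E t ^ Suc n) x"
    by (simp add: algebra_simps)
  finally show ?case .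
qed simp

section \<open>The Dyson series of a linear system with integrable coefficients\<close>

text \<open>The terms of the Picard iteration for \<open>y' = A y\<close> with \<open>y(-\<infinity>) = v\<close>.\<close>
primrec dyson_term ::
  "'i set \<Rightarrow> ('i \<Rightarrow> 'i \<Rightarrow> real \<Rightarrow> complex) \<Rightarrow> ('i \<Rightarrow> complex) \<Rightarrow> nat \<Rightarrow> 'i \<Rightarrow> real \<Rightarrow> complex" where
  "dyson_term J A v 0 j x = v j"
| "dyson_term J A v (Suc n) j x = integral_upto (\<lambda>t. \<Sum>l\<in>J. A j l t * dyson_term J A v n l t) x"

definition dyson_series ::
  "'i set \<Rightarrow> ('i \<Rightarrow> 'i \<Rightarrow> real \<Rightarrow> complex) \<Rightarrow> ('i \<Rightarrow> complex) \<Rightarrow> 'i \<Rightarrow> real \<Rightarrow> complex" where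
  "dyson_series J A v j x = (\<Sum>n. dyson_term J A v n j x)"

locale integrable_system =
  fixes J :: "'i set" and A :: "'i \<Rightarrow> 'i \<Rightarrow> real \<Rightarrow> complex" and v :: "'i \<Rightarrow> complex" and M :: "real \<Rightarrow> real"
  assumes coeff_measurable: "\<And>j l. j \<in> J \<Longrightarrow> l \<in> J \<Longrightarrow> A j l \<in> borel_measurable lebesgue"
    and coeff_le: "\<And>j t. j \<in> J \<Longrightarrow> (\<Sum>l\<in>J. cmod (A j l t)) \<le> M t"
    and init_le: "\<And>j. j \<in> J \<Longrightarrow> cmod (v j) \<le> 1"
    and M_nonneg: "\<And>t. 0 \<le> M t"
    and M_integrable: "integrable lebesgue M"
begin

abbreviation "E \<equiv> integral_upto M"

lemma E_nonneg: "0 \<le> E x"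
  unfolding set_lebesgue_integral_def by (rule integral_nonneg_AE) (simp add: M_nonneg)

lemma E_le: "E x \<le> integral\<^sup>L lebesgue M"
  by (rule set_integral_le_integral[OF M_integrable M_nonneg]) simp

lemma apply_coeff_le:
  assumes "j \<in> J" and "\<And>l. l \<in> J \<Longrightarrow> cmod (y l) \<le> B"
  shows "cmod (\<Sum>l\<in>J. A j l t * y l) \<le> M t * B"
proof (cases "J = {}")
  case False
  then have B: "0 \<le> B" using assms(2) norm_ge_zero order_trans by (metis ex_in_conv)
  have "cmod (\<Sum>l\<in>J. A j l t * y l) \<le> (\<Sum>l\<in>J. cmod (A j l t) * B)"
    by (rule order_trans[OF norm_sum sum_mono]) (auto simp: norm_mult intro!: mult_left_mono assms)
  also have "\<dots> \<le> M t * B"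
    unfolding sum_distrib_right[symmetric] by (rule mult_right_mono[OF coeff_le[OF \<open>j \<in> J\<close>] B])
  finally show ?thesis .
qed (use assms in auto)

lemma apply_coeff_integrable:
  assumes j: "j \<in> J" and y: "\<And>l. l \<in> J \<Longrightarrow> y l \<in> borel_measurable lebesgue"
    and le: "\<And>l t. l \<in> J \<Longrightarrow> cmod (y l t) \<le> B t" and B: "integrable lebesgue (\<lambda>t. M t * B t)"
  shows "integrable lebesgue (\<lambda>t. \<Sum>l\<in>J. A j l t * y l t)"
proof (rule Bochner_Integration.integrable_bound[OF B])
  show "(\<lambda>t. \<Sum>l\<in>J. A j l t * y l t) \<in> borel_measurable lebesgue"
    by (intro borel_measurable_sum borel_measurable_times coeff_measurable y j)
  show "AE t in lebesgue. norm (\<Sum>l\<in>J. A j l t * y l t) \<le> norm (M t * B t)"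
    by (rule AE_I2, rule order_trans[OF apply_coeff_le[OF j le]]) auto
qed

text \<open>Measurability and the estimate are proved together because the induction step needs both to know that the
next integrand is integrable. The factorial comes from \<open>integral_upto_power\<close>.\<close>
lemma dyson_term_measurable_and_le:
  assumes "j \<in> J"
  shows "dyson_term J A v n j \<in> borel_measurable lebesgue"
    and "cmod (dyson_term J A v n j x) \<le> E x ^ n / fact n"
proof -
  have "dyson_term J A v n j \<in> borel_measurable lebesgue \<and>
      (\<forall>x. cmod (dyson_term J A v n j x) \<le> E x ^ n / fact n)"
    using assms
  proof (induction n arbitrary: j)
    case 0
    then show ?case using init_le by auto
  next
    case (Suc n)
    let ?f = "\<lambda>t. \<Sum>l\<in>J. A j l t * dyson_term J A v n l t"
    have pow: "integrable lebesgue (\<lambda>t. M t * (E t ^ n / fact n))"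
      using integrable_mult_integral_upto_power[OF M_integrable M_nonneg, of n] by simp
    have int: "integrable lebesgue ?f"
      by (rule apply_coeff_integrable[OF Suc.prems _ _ pow]) (use Suc.IH in auto)
    have "dyson_term J A v (Suc n) j \<in> borel_measurable lborel"
      using borel_measurable_continuous_onI[OF continuous_integral_upto[OF int]]
      by (simp add: fun_eq_iff cong: measurable_cong)
    then have "dyson_term J A v (Suc n) j \<in> borel_measurable lebesgue"
      by (rule measurable_completion)
    moreover have "cmod (dyson_term J A v (Suc n) j x) \<le> E x ^ Suc n / fact (Suc n)" for x
    proof -
      have "cmod (integral_upto ?f x) \<le> integral_upto (\<lambda>t. cmod (?f t)) x"
        by (rule set_integral_norm_bound[OF integrable_imp_set_integrable[OF int]]) simp
      also have "\<dots> \<le> integral_upto (\<lambda>t. M t * (E t ^ n / fact n)) x"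
      proof (rule set_integral_mono)
        show "set_integrable lebesgue {..x} (\<lambda>t. cmod (?f t))"
          by (rule integrable_imp_set_integrable[OF integrable_norm[OF int]]) simp
        show "set_integrable lebesgue {..x} (\<lambda>t. M t * (E t ^ n / fact n))"
          by (rule integrable_imp_set_integrable[OF pow]) simp
        show "cmod (?f t) \<le> M t * (E t ^ n / fact n)" for t
          by (rule apply_coeff_le[OF Suc.prems]) (use Suc.IH in auto)
      qed
      also have "\<dots> = integral_upto (\<lambda>t. M t * E t ^ n) x / fact n"
        by simp
      also have "\<dots> = E x ^ Suc n / fact (Suc n)"
        unfolding integral_upto_power[OF M_integrable M_nonneg] by (simp add: divide_simps)
      finally show ?thesis by simp
    qed
    ultimately show ?case by blast
  qed
  then show "dyson_term J A v n j \<in> borel_measurable lebesgue"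
    and "cmod (dyson_term J A v n j x) \<le> E x ^ n / fact n" by auto
qed

lemma dyson_term_le:
  assumes "j \<in> J"
  shows "cmod (dyson_term J A v n j x) \<le> integral\<^sup>L lebesgue M ^ n / fact n"
  by (rule order_trans[OF dyson_term_measurable_and_le(2)[OF assms]])
     (intro divide_right_mono power_mono E_le E_nonneg, simp)

lemma dyson_term_integrand_integrable:
  assumes "j \<in> J"
  shows "integrable lebesgue (\<lambda>t. \<Sum>l\<in>J. A j l t * dyson_term J A v n l t)"
  by (rule apply_coeff_integrable[OF assms _ _ integrable_mult_left[OF M_integrable]])
     (auto intro!: dyson_term_measurable_and_le(1) dyson_term_le)

lemma summable_bound: "summable (\<lambda>n. integral\<^sup>L lebesgue M ^ n / fact n)"
  using summable_exp[of "integral\<^sup>L lebesgue M"] by (simp add: field_simps)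

lemma summable_dyson_term: "j \<in> J \<Longrightarrow> summable (\<lambda>n. dyson_term J A v n j x)"
  by (rule summable_comparison_test'[OF summable_bound dyson_term_le])

lemma dyson_series_measurable:
  assumes "j \<in> J"
  shows "dyson_series J A v j \<in> borel_measurable lebesgue"
proof -
  have "(\<lambda>x. \<Sum>n. dyson_term J A v n j x) \<in> borel_measurable lebesgue"
    by (rule borel_measurable_suminf) (rule dyson_term_measurable_and_le(1)[OF assms])
  then show ?thesis by (simp add: dyson_series_def[abs_def])
qed

lemma dyson_series_le:
  assumes "j \<in> J"
  shows "cmod (dyson_series J A v j x) \<le> (\<Sum>n. integral\<^sup>L lebesgue M ^ n / fact n)"
proof -
  have summable: "summable (\<lambda>n. cmod (dyson_term J A v n j x))"
    by (rule summable_comparison_test'[OF summable_bound]) (use dyson_term_le[OF assms] in simp)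
  show ?thesis unfolding dyson_series_def
    by (rule order_trans[OF summable_norm[OF summable] suminf_le[OF dyson_term_le[OF assms] summable summable_bound]])
qed

text \<open>The integrands of the terms are dominated by \<open>M(t) (\<integral>M)\<^sup>n / n!\<close>, whose integrals are summable, so that sum
and integral may be exchanged.\<close>
lemma dyson_series_eq:
  assumes j: "j \<in> J"
  shows "dyson_series J A v j x = v j + integral_upto (\<lambda>t. \<Sum>l\<in>J. A j l t * dyson_series J A v l t) x"
proof -
  let ?B = "integral\<^sup>L lebesgue M"
  let ?f = "\<lambda>n t. indicat_real {..x} t *\<^sub>R (\<Sum>l\<in>J. A j l t * dyson_term J A v n l t)"
  have f_int: "integrable lebesgue (?f n)" for n
    using integrable_imp_set_integrable[OF dyson_term_integrand_integrable[OF j], of "{..x}"]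
    by (simp add: set_integrable_def)
  have f_le: "norm (?f n t) \<le> M t * (?B ^ n / fact n)" for n t
  proof -
    have "cmod (\<Sum>l\<in>J. A j l t * dyson_term J A v n l t) \<le> M t * (?B ^ n / fact n)"
      by (rule apply_coeff_le[OF j dyson_term_le])
    from this order_trans[OF norm_ge_zero this] show ?thesis by (simp add: indicator_def)
  qed
  have sums: "(\<lambda>n. integral\<^sup>L lebesgue (?f n)) sums (LINT t|lebesgue. (\<Sum>n. ?f n t))"
  proof (rule sums_integral[OF f_int])
    show "AE t in lebesgue. summable (\<lambda>n. norm (?f n t))"
    proof (rule AE_I2)
      fix t show "summable (\<lambda>n. norm (?f n t))"
        by (rule summable_comparison_test'[OF summable_mult[OF summable_bound, of "M t"]])
           (use f_le in simp)
    qed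
    show "summable (\<lambda>n. LINT t|lebesgue. norm (?f n t))"
    proof (rule summable_comparison_test'[OF summable_mult[OF summable_bound, of ?B]])
      fix n :: nat
      have "(LINT t|lebesgue. norm (?f n t)) \<le> (LINT t|lebesgue. M t * (?B ^ n / fact n))"
        by (rule integral_mono[OF integrable_norm[OF f_int]]) (use M_integrable f_le in auto)
      then show "norm (LINT t|lebesgue. norm (?f n t)) \<le> ?B * (?B ^ n / fact n)"
        by (simp add: integral_nonneg_AE)
    qed
  qed
  have "(\<Sum>n. ?f n t) = indicat_real {..x} t *\<^sub>R (\<Sum>l\<in>J. A j l t * dyson_series J A v l t)" for t
  proof -
    have summable: "summable (\<lambda>n. A j l t * dyson_term J A v n l t)" if "l \<in> J" for l
      by (rule summable_mult[OF summable_dyson_term[OF that]])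
    have "(\<Sum>n. ?f n t) = indicat_real {..x} t *\<^sub>R (\<Sum>n. \<Sum>l\<in>J. A j l t * dyson_term J A v n l t)"
      by (rule suminf_scaleR_right[symmetric]) (rule summable_sum[OF summable])
    also have "(\<Sum>n. \<Sum>l\<in>J. A j l t * dyson_term J A v n l t) = (\<Sum>l\<in>J. \<Sum>n. A j l t * dyson_term J A v n l t)"
      by (rule suminf_sum[OF summable])
    also have "\<dots> = (\<Sum>l\<in>J. A j l t * dyson_series J A v l t)"
      unfolding dyson_series_def
      by (rule sum.cong[OF refl], rule suminf_mult[OF summable_dyson_term])
    finally show ?thesis .
  qed
  with sums have "(\<lambda>n. dyson_term J A v (Suc n) j x) sums
      integral_upto (\<lambda>t. \<Sum>l\<in>J. A j l t * dyson_series J A v l t) x"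
    by (simp add: set_lebesgue_integral_def)
  from sums_unique[OF this] suminf_split_head[OF summable_dyson_term[OF j], of x] show ?thesis
    by (simp add: dyson_series_def)
qed

end

section \<open>Holomorphic dependence on a parameter\<close>

text \<open>A bound \<open>B t\<close> on \<open>f(\<cdot>, t)\<close> controls its derivative by Cauchy's inequality, so the difference quotients
in the parameter are dominated by a multiple of \<open>B\<close> and converge under the integral.\<close>
lemma holomorphic_integral_parameter:
  fixes f :: "complex \<Rightarrow> 'a \<Rightarrow> complex"
  assumes S: "open S"
    and hol: "\<And>t. t \<in> space N \<Longrightarrow> (\<lambda>z. f z t) holomorphic_on S"
    and meas: "\<And>z. z \<in> S \<Longrightarrow> f z \<in> borel_measurable N"
    and le: "\<And>z t. z \<in> S \<Longrightarrow> t \<in> space N \<Longrightarrow> cmod (f z t) \<le> B t"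
    and B: "integrable N B"
  shows "(\<lambda>z. integral\<^sup>L N (f z)) holomorphic_on S"
  unfolding holomorphic_on_open[OF S]
proof
  fix z assume z: "z \<in> S"
  obtain r where r: "r > 0" "cball z r \<subseteq> S"
    using S z open_contains_cball by blast
  have int: "integrable N (f w)" if "w \<in> S" for w
    by (rule Bochner_Integration.integrable_bound[OF B meas[OF that]])
       (use le[OF that] in \<open>force intro!: AE_I2\<close>)
  have Lipschitz: "cmod (f w t - f z t) \<le> 2 / r * B t * cmod (w - z)" if "w \<in> ball z (r / 2)" "t \<in> space N" for w t
  proof (rule field_differentiable_bound[OF convex_ball, where f' = "\<lambda>w. deriv (\<lambda>w. f w t) w"])
    fix w' assume w': "w' \<in> ball z (r / 2)"
    have sub: "cball w' (r / 2) \<subseteq> S"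
    proof
      fix y assume "y \<in> cball w' (r / 2)"
      then show "y \<in> S" using r w' dist_triangle[of z y w'] by (intro subsetD[OF r(2)]) auto
    qed
    then have "w' \<in> S" using r by auto
    show "((\<lambda>w. f w t) has_field_derivative deriv (\<lambda>w. f w t) w') (at w' within ball z (r / 2))"
      by (rule has_field_derivative_at_within, rule holomorphic_derivI[OF hol S \<open>w' \<in> S\<close>]) fact
    have "norm ((deriv ^^ 1) (\<lambda>w. f w t) w') \<le> fact 1 * B t / (r / 2) ^ 1"
    proof (rule Cauchy_inequality)
      show "(\<lambda>w. f w t) holomorphic_on ball w' (r / 2)"
        using holomorphic_on_subset[OF hol[OF that(2)]] sub ball_subset_cball by blast
      show "continuous_on (cball w' (r / 2)) (\<lambda>w. f w t)"
        using holomorphic_on_imp_continuous_on[OF holomorphic_on_subset[OF hol[OF that(2)] sub]] .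
      show "norm (f y t) \<le> B t" if "norm (w' - y) = r / 2" for y
        using that sub by (intro le \<open>t \<in> space N\<close>) (auto simp: dist_norm)
    qed (use r in auto)
    then show "norm (deriv (\<lambda>w. f w t) w') \<le> 2 / r * B t" by (simp add: field_simps)
  qed (use that r in auto)
  let ?D = "\<lambda>t. deriv (\<lambda>w. f w t) z"
  have "((\<lambda>w. (integral\<^sup>L N (f w) - integral\<^sup>L N (f z)) / (w - z)) \<longlongrightarrow> integral\<^sup>L N ?D) (at z)"
    unfolding tendsto_at_iff_sequentially comp_def
  proof (intro allI impI)
    fix X assume X: "\<forall>i. X i \<in> UNIV - {z}" "X \<longlonglongrightarrow> z"
    then have "\<forall>\<^sub>F n in sequentially. X n \<in> ball z (r / 2)"
      using r by (intro topological_tendstoD) auto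
    then obtain n0 where n0: "\<And>n. n \<ge> n0 \<Longrightarrow> X n \<in> ball z (r / 2)"
      by (auto simp: eventually_sequentially)
    define Y where "Y n = X (n + n0)" for n
    have Y: "Y n \<in> ball z (r / 2)" "Y n \<noteq> z" for n using n0 X(1) by (auto simp: Y_def)
    have Y_lim: "Y \<longlonglongrightarrow> z" unfolding Y_def by (rule LIMSEQ_ignore_initial_segment[OF X(2)])
    have Y_S: "Y n \<in> S" for n using Y(1)[of n] r by (intro subsetD[OF r(2)]) auto
    let ?q = "\<lambda>n t. (f (Y n) t - f z t) / (Y n - z)"
    have q_meas: "?q n \<in> borel_measurable N" for n
      by (intro borel_measurable_divide borel_measurable_diff meas Y_S z borel_measurable_const)
    have q_lim: "(\<lambda>n. ?q n t) \<longlonglongrightarrow> ?D t" if "t \<in> space N" for t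
    proof -
      have "((\<lambda>w. f w t) has_field_derivative ?D t) (at z)"
        by (rule holomorphic_derivI[OF hol[OF that] S z])
      then have "((\<lambda>w. (f w t - f z t) / (w - z)) \<longlongrightarrow> ?D t) (at z)"
        by (simp add: has_field_derivative_iff)
      then show ?thesis using Y Y_lim
        unfolding tendsto_at_iff_sequentially comp_def by blast
    qed
    have "(\<lambda>n. integral\<^sup>L N (?q n)) \<longlonglongrightarrow> integral\<^sup>L N ?D"
    proof (rule integral_dominated_convergence[where w = "\<lambda>t. 2 / r * B t"])
      show "?D \<in> borel_measurable N"
        by (rule borel_measurable_LIMSEQ_metric[OF q_meas q_lim])
      show "AE t in N. norm (?q n t) \<le> 2 / r * B t" for n
        using Lipschitz[OF Y(1)[of n]] Y(2)[of n] by (auto intro!: AE_I2 simp: norm_divide divide_simps)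
    qed (use B q_meas q_lim in auto)
    moreover have "integral\<^sup>L N (?q n) = (integral\<^sup>L N (f (Y n)) - integral\<^sup>L N (f z)) / (Y n - z)" for n
      using Y(2)[of n] by (simp add: int Y_S z)
    ultimately have "(\<lambda>n. (integral\<^sup>L N (f (Y n)) - integral\<^sup>L N (f z)) / (Y n - z)) \<longlonglongrightarrow> integral\<^sup>L N ?D"
      by (simp only:)
    then show "(\<lambda>n. (integral\<^sup>L N (f (X n)) - integral\<^sup>L N (f z)) / (X n - z)) \<longlonglongrightarrow> integral\<^sup>L N ?D"
      unfolding Y_def by (rule LIMSEQ_offset)
  qed
  then show "\<exists>f'. ((\<lambda>z. integral\<^sup>L N (f z)) has_field_derivative f') (at z)"
    by (auto simp: has_field_derivative_iff)
qed

text \<open>One majorant \<open>M\<close> serves all parameters, so each term is holomorphic by differentiation under the integral and the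
convergence is uniform by the Weierstrass test.\<close>
lemma holomorphic_dyson_series:
  fixes A :: "complex \<Rightarrow> 'i \<Rightarrow> 'i \<Rightarrow> real \<Rightarrow> complex"
  assumes S: "open S"
    and M: "integrable lebesgue M"
    and sys: "\<And>z. z \<in> S \<Longrightarrow> integrable_system J (A z) v M"
    and hol: "\<And>j l t. j \<in> J \<Longrightarrow> l \<in> J \<Longrightarrow> (\<lambda>z. A z j l t) holomorphic_on S"
    and j: "j \<in> J"
  shows "(\<lambda>z. dyson_series J (A z) v j x) holomorphic_on S"
proof -
  let ?B = "integral\<^sup>L lebesgue M"
  have dyson_term: "(\<lambda>z. dyson_term J (A z) v n j x) holomorphic_on S" if "j \<in> J" for n j x
    using that
  proof (induction n arbitrary: j x)
    case (Suc n)
    have "(\<lambda>z. LINT t|lebesgue. indicat_real {..x} t *\<^sub>R (\<Sum>l\<in>J. A z j l t * dyson_term J (A z) v n l t)) holomorphic_on S"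
    proof (rule holomorphic_integral_parameter[OF S])
      fix t :: real
      have "(\<lambda>z. of_real (indicat_real {..x} t) * (\<Sum>l\<in>J. A z j l t * dyson_term J (A z) v n l t)) holomorphic_on S"
        by (intro holomorphic_intros hol Suc)
      then show "(\<lambda>z. indicat_real {..x} t *\<^sub>R (\<Sum>l\<in>J. A z j l t * dyson_term J (A z) v n l t)) holomorphic_on S"
        by (simp add: scaleR_conv_of_real)
    next
      fix z assume "z \<in> S"
      then interpret integrable_system J "A z" v M by (rule sys)
      show "(\<lambda>t. indicat_real {..x} t *\<^sub>R (\<Sum>l\<in>J. A z j l t * dyson_term J (A z) v n l t)) \<in> borel_measurable lebesgue"
        using integrable_imp_set_integrable[OF dyson_term_integrand_integrable[OF \<open>j \<in> J\<close>], of "{..x}"]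
        by (simp add: set_integrable_def borel_measurable_integrable)
      fix t :: real
      have "cmod (\<Sum>l\<in>J. A z j l t * dyson_term J (A z) v n l t) \<le> M t * (?B ^ n / fact n)"
        by (rule apply_coeff_le[OF \<open>j \<in> J\<close> dyson_term_le])
      from this order_trans[OF norm_ge_zero this]
      show "cmod (indicat_real {..x} t *\<^sub>R (\<Sum>l\<in>J. A z j l t * dyson_term J (A z) v n l t)) \<le> M t * (?B ^ n / fact n)"
        by (simp add: indicator_def)
    next
      show "integrable lebesgue (\<lambda>t. M t * (?B ^ n / fact n))"
        using M by simp
    qed
    then show ?case by (simp add: set_lebesgue_integral_def)
  qed simp
  show ?thesis
  proof (rule holomorphic_uniform_sequence[OF S, where f = "\<lambda>n z. \<Sum>i<n. dyson_term J (A z) v i j x"])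
    show "(\<lambda>z. \<Sum>i<n. dyson_term J (A z) v i j x) holomorphic_on S" for n
      by (intro holomorphic_intros dyson_term j)
    fix z assume z: "z \<in> S"
    interpret integrable_system J "A z" v M by (rule sys[OF z])
    obtain d where d: "d > 0" "cball z d \<subseteq> S" using S z open_contains_cball by blast
    have "uniform_limit (cball z d) (\<lambda>n z. \<Sum>i<n. dyson_term J (A z) v i j x)
        (\<lambda>z. \<Sum>i. dyson_term J (A z) v i j x) sequentially"
    proof (rule Weierstrass_m_test[OF _ summable_bound])
      fix n w assume "w \<in> cball z d"
      then interpret w: integrable_system J "A w" v M using d by (intro sys) auto
      show "norm (dyson_term J (A w) v n j x) \<le> ?B ^ n / fact n" by (rule w.dyson_term_le[OF j])
    qed
    then show "\<exists>d>0. cball z d \<subseteq> S \<and> uniform_limit (cball z d)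
        (\<lambda>n z. \<Sum>i<n. dyson_term J (A z) v i j x) (\<lambda>z. dyson_series J (A z) v j x) sequentially"
      using d unfolding dyson_series_def by blast
  qed
qed

section \<open>Derivatives of products with a vanishing factor\<close>

lemma has_vector_derivative_iff_tendsto:
  "(f has_vector_derivative f') (at x) \<longleftrightarrow> ((\<lambda>y. (f y - f x) /\<^sub>R (y - x)) \<longlongrightarrow> f') (at x)"
proof -
  have eq: "norm (f y - f x - (y - x) *\<^sub>R f') / norm (y - x) = norm ((f y - f x) /\<^sub>R (y - x) - f')"
    if "y \<noteq> x" for y
  proof -
    have "(f y - f x) /\<^sub>R (y - x) - f' = (f y - f x - (y - x) *\<^sub>R f') /\<^sub>R (y - x)"
      using that by (simp add: scaleR_right_diff_distrib)
    then show ?thesis by (simp add: divide_inverse mult.commute)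
  qed
  have "(f has_vector_derivative f') (at x) \<longleftrightarrow>
      ((\<lambda>y. norm (f y - f x - (y - x) *\<^sub>R f') / norm (y - x)) \<longlongrightarrow> 0) (at x)"
    by (simp add: has_vector_derivative_def has_derivative_iff_norm bounded_linear_scaleR_left)
  also have "\<dots> \<longleftrightarrow> ((\<lambda>y. norm ((f y - f x) /\<^sub>R (y - x) - f')) \<longlongrightarrow> 0) (at x)"
    by (rule tendsto_cong) (use eq in \<open>auto simp: eventually_at intro!: exI[of _ 1]\<close>)
  also have "\<dots> \<longleftrightarrow> ((\<lambda>y. (f y - f x) /\<^sub>R (y - x)) \<longlongrightarrow> f') (at x)"
    by (simp add: tendsto_norm_zero_iff LIM_zero_iff)
  finally show ?thesis .
qed

text \<open>The product rule without differentiability of the second factor, whose derivative would be multiplied by \<open>f x = 0\<close>.\<close>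
lemma has_vector_derivative_mult_vanishing:
  fixes f h :: "real \<Rightarrow> complex"
  assumes f: "(f has_vector_derivative f') (at x)" and "f x = 0" and h: "isCont h x"
  shows "((\<lambda>y. f y * h y) has_vector_derivative f' * h x) (at x)"
proof -
  have "((\<lambda>y. (f y - f x) /\<^sub>R (y - x)) \<longlongrightarrow> f') (at x)"
    using f by (simp add: has_vector_derivative_iff_tendsto)
  then have "((\<lambda>y. (f y - f x) /\<^sub>R (y - x) * h y) \<longlongrightarrow> f' * h x) (at x)"
    using h by (intro tendsto_mult) (auto simp: isCont_def)
  then show ?thesis using \<open>f x = 0\<close> by (simp add: has_vector_derivative_iff_tendsto)
qed

text \<open>Although \<open>W\<close> may be unbounded near \<open>x\<close>, the increment over \<open>[x, y]\<close> is at most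
\<open>K |y - x| \<integral>|W|\<close>, since \<open>|\<psi> t| \<le> K |t - x|\<close> there, and the integral of \<open>|W|\<close> over \<open>[x, y]\<close> tends to \<open>0\<close>.\<close>
lemma has_vector_derivative_integral_upto_vanishing:
  fixes \<psi> W :: "real \<Rightarrow> complex"
  assumes W: "integrable lebesgue W" and prod: "integrable lebesgue (\<lambda>t. \<psi> t * W t)"
    and \<psi>: "(\<psi> has_vector_derivative \<psi>') (at x)" and zero: "\<psi> x = 0"
  shows "(integral_upto (\<lambda>t. \<psi> t * W t) has_vector_derivative 0) (at x)"
  unfolding has_vector_derivative_def has_derivative_at_alt
proof (intro conjI allI impI)
  fix e :: real assume e: "e > 0"
  obtain d1 where d1: "d1 > 0" "\<And>t. \<bar>t - x\<bar> < d1 \<Longrightarrow> cmod (\<psi> t - \<psi> x - (t - x) *\<^sub>R \<psi>') \<le> 1 * \<bar>t - x\<bar>"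
    using \<psi>[unfolded has_vector_derivative_def has_derivative_at_alt] zero_less_one by (metis real_norm_def)
  define K where "K = cmod \<psi>' + 1"
  have K: "K > 0" by (simp add: K_def add_nonneg_pos)
  have \<psi>_le: "cmod (\<psi> t) \<le> K * \<bar>t - x\<bar>" if "\<bar>t - x\<bar> < d1" for t
  proof -
    have "cmod (\<psi> t) \<le> cmod (\<psi> t - (t - x) *\<^sub>R \<psi>') + cmod ((t - x) *\<^sub>R \<psi>')"
      using norm_triangle_sub[of "\<psi> t" "(t - x) *\<^sub>R \<psi>'"] by (simp add: add.commute)
    also have "\<dots> \<le> \<bar>t - x\<bar> + \<bar>t - x\<bar> * cmod \<psi>'" using d1(2)[OF that] zero by simp
    finally show ?thesis by (simp add: K_def algebra_simps)
  qed
  let ?N = "integral_upto (\<lambda>t. cmod (W t))"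
  have W': "integrable lebesgue (\<lambda>t. cmod (W t))" using W by simp
  have "(?N \<longlongrightarrow> ?N x) (at x)" by (rule tendsto_integral_upto[OF W'])
  then obtain d2 where d2: "d2 > 0" "\<And>y. \<bar>y - x\<bar> < d2 \<Longrightarrow> \<bar>?N y - ?N x\<bar> < e / K"
    using e K unfolding LIM_def by (metis (no_types) dist_real_def divide_pos_pos abs_0 diff_self)
  have incr: "cmod (integral_upto (\<lambda>t. \<psi> t * W t) b - integral_upto (\<lambda>t. \<psi> t * W t) a) \<le> K * h * (?N b - ?N a)"
    if "a \<le> b" "\<And>t. t \<in> {a<..b} \<Longrightarrow> \<bar>t - x\<bar> < d1 \<and> \<bar>t - x\<bar> \<le> h" for a b h
  proof -
    have "cmod (integral_upto (\<lambda>t. \<psi> t * W t) b - integral_upto (\<lambda>t. \<psi> t * W t) a)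
        \<le> (LINT t:{a<..b}|lebesgue. cmod (\<psi> t * W t))"
      by (rule norm_integral_upto_diff_le[OF prod that(1)])
    also have "\<dots> \<le> (LINT t:{a<..b}|lebesgue. K * h * cmod (W t))"
    proof (rule set_integral_mono)
      show "set_integrable lebesgue {a<..b} (\<lambda>t. cmod (\<psi> t * W t))"
        by (rule integrable_imp_set_integrable[OF integrable_norm[OF prod]]) simp
      show "set_integrable lebesgue {a<..b} (\<lambda>t. K * h * cmod (W t))"
        by (rule integrable_imp_set_integrable[OF integrable_mult_right[OF W']]) simp
      fix t assume t: "t \<in> {a<..b}"
      have "cmod (\<psi> t) \<le> K * h"
        using \<psi>_le[of t] mult_left_mono[of "\<bar>t - x\<bar>" h K] that(2)[OF t] K by linarith
      then show "cmod (\<psi> t * W t) \<le> K * h * cmod (W t)"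
        by (simp add: norm_mult mult_right_mono)
    qed
    also have "\<dots> = K * h * (?N b - ?N a)"
      using integral_upto_diff[OF W' that(1)] by simp
    finally show ?thesis .
  qed
  show "\<exists>d>0. \<forall>y. norm (y - x) < d \<longrightarrow>
      norm (integral_upto (\<lambda>t. \<psi> t * W t) y - integral_upto (\<lambda>t. \<psi> t * W t) x - (y - x) *\<^sub>R 0) \<le> e * norm (y - x)"
  proof (intro exI[of _ "min d1 d2"] conjI allI impI)
    fix y assume y: "norm (y - x) < min d1 d2"
    have "cmod (integral_upto (\<lambda>t. \<psi> t * W t) y - integral_upto (\<lambda>t. \<psi> t * W t) x)
        \<le> K * \<bar>y - x\<bar> * \<bar>?N y - ?N x\<bar>"
    proof (cases "x \<le> y")
      case True
      have "cmod (integral_upto (\<lambda>t. \<psi> t * W t) y - integral_upto (\<lambda>t. \<psi> t * W t) x) \<le> K * \<bar>y - x\<bar> * (?N y - ?N x)"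
        by (rule incr[OF True]) (use y in auto)
      also have "\<dots> \<le> K * \<bar>y - x\<bar> * \<bar>?N y - ?N x\<bar>" using K by (intro mult_left_mono) auto
      finally show ?thesis .
    next
      case False
      have "cmod (integral_upto (\<lambda>t. \<psi> t * W t) x - integral_upto (\<lambda>t. \<psi> t * W t) y) \<le> K * \<bar>y - x\<bar> * (?N x - ?N y)"
        by (rule incr) (use y False in auto)
      also have "\<dots> \<le> K * \<bar>y - x\<bar> * \<bar>?N y - ?N x\<bar>" using K by (intro mult_left_mono) auto
      finally show ?thesis by (simp add: norm_minus_commute)
    qed
    also have "\<dots> \<le> K * \<bar>y - x\<bar> * (e / K)"
      using d2(2)[of y] y K by (intro mult_left_mono) auto
    also have "\<dots> = e * norm (y - x)" using K by simp
    finally show "norm (integral_upto (\<lambda>t. \<psi> t * W t) y - integral_upto (\<lambda>t. \<psi> t * W t) x - (y - x) *\<^sub>R 0)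
        \<le> e * norm (y - x)" by simp
  qed (use d1 d2 in auto)
qed simp

section \<open>Exponential modes of the free equation\<close>

abbreviation cube_indices :: "nat set" where "cube_indices \<equiv> {0, 1, 2}"

lemma zeta_cube: "zeta k ^ 3 = 1"
  by (simp add: zeta_def complex_eq_iff power3_eq_cube field_simps)

lemma zeta_nonzero: "zeta k \<noteq> 0"
  using zeta_cube[of k] by auto

lemma inverse_zeta: "1 / zeta k = zeta k ^ 2"
  using zeta_cube[of k] zeta_nonzero[of k] by (simp add: field_simps power2_eq_square power3_eq_cube)

lemma inverse_zeta_square: "1 / zeta k ^ 2 = zeta k"
  using zeta_cube[of k] zeta_nonzero[of k] by (simp add: field_simps power2_eq_square power3_eq_cube)

lemma sum_zeta: "(\<Sum>l\<in>cube_indices. zeta l) = 0"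
  by (simp add: zeta_def complex_eq_iff)

lemma sum_zeta_square: "(\<Sum>l\<in>cube_indices. zeta l ^ 2) = 0"
  by (simp add: zeta_def complex_eq_iff power2_eq_square)

lemma norm_zeta: "cmod (zeta k) = 1"
proof -
  have "cmod (zeta k) ^ 3 = 1" using zeta_cube[of k] by (metis norm_one norm_power)
  then show ?thesis using power_eq_imp_eq_base[of "cmod (zeta k)" 3 1] by simp
qed

definition mode :: "complex \<Rightarrow> nat \<Rightarrow> real \<Rightarrow> complex" where
  "mode lam l x = exp (- \<i> * lam * zeta l * of_real x)"

lemma mode_add: "mode lam l (x + y) = mode lam l x * mode lam l y"
  unfolding mode_def exp_add[symmetric] by (simp add: algebra_simps)

lemma mode_diff: "mode lam l (x - y) = mode lam l x * mode lam l (- y)"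
  using mode_add[of lam l x "- y"] by simp

lemma mode_minus [simp]: "mode lam l x * mode lam l (- x) = 1" "mode lam l (- x) * mode lam l x = 1"
  using mode_add[of lam l x "- x"] by (auto simp: mode_def mult.commute)

lemma mode_deriv: "(mode lam l has_vector_derivative (- \<i> * lam * zeta l) * mode lam l x) (at x)"
proof -
  have "((\<lambda>z. exp (- \<i> * lam * zeta l * z)) has_field_derivative
      (- \<i> * lam * zeta l) * exp (- \<i> * lam * zeta l * of_real x)) (at (of_real x))"
    by (auto intro!: derivative_eq_intros)
  from has_vector_derivative_real_field[OF this] show ?thesis
    by (simp add: mode_def[abs_def])
qed

lemma mode_uminus: "mode lam l (- x) = mode (- lam) l x"
  by (simp add: mode_def)

lemma mode_differentiable: "mode lam l differentiable at x"
  using mode_deriv by (rule differentiableI_vector)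

lemma continuous_on_mode: "continuous_on S (mode lam l)"
  unfolding mode_def by (intro continuous_intros)

lemma mode_measurable: "mode lam l \<in> borel_measurable lebesgue"
  by (intro measurable_completion) (simp add: borel_measurable_continuous_onI continuous_on_mode)

lemma norm_mode_le: "cmod (mode lam l x) \<le> exp (cmod lam * \<bar>x\<bar>)"
  unfolding mode_def by (rule order_trans[OF norm_exp]) (simp add: norm_mult norm_zeta)

lemma s_eq_modes:
  "s r (- \<i> * lam * of_real (x - t)) = (\<Sum>l\<in>cube_indices. 1 / (3 * zeta l ^ r) * mode lam l x * mode lam l (- t))"
proof -
  have "exp (- \<i> * lam * of_real (x - t) * zeta l) = mode lam l x * mode lam l (- t)" for l
  proof -
    have "exp (- \<i> * lam * of_real (x - t) * zeta l) = mode lam l (x - t)"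
      by (simp only: mode_def mult_ac)
    then show ?thesis by (simp only: mode_diff)
  qed
  then show ?thesis
    unfolding s_def sum_distrib_left by (intro sum.cong refl) (simp only: divide_simps mult_ac, simp)
qed

definition variation_coeff :: "complex \<Rightarrow> nat \<Rightarrow> complex" where
  "variation_coeff lam l = zeta l / (3 * (- \<i> * lam)\<^sup>2)"

text \<open>These are the initial values of the Green's function: a forcing term \<open>w\<close>, distributed over the modes with the factors
\<open>variation_coeff\<close>, leaves the function and its first two derivatives unaffected and adds exactly \<open>w\<close> to the third.\<close>
lemma sum_variation_coeff:
  assumes "lam \<noteq> 0"
  shows "(\<Sum>l\<in>cube_indices. variation_coeff lam l) = 0"
    and "(\<Sum>l\<in>cube_indices. (- \<i> * lam * zeta l) * variation_coeff lam l) = 0"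
    and "(\<Sum>l\<in>cube_indices. (- \<i> * lam * zeta l)\<^sup>2 * variation_coeff lam l) = 1"
proof -
  have "(\<Sum>l\<in>cube_indices. variation_coeff lam l) = (\<Sum>l\<in>cube_indices. zeta l) / (3 * (- \<i> * lam)\<^sup>2)"
    by (simp only: variation_coeff_def sum_divide_distrib)
  then show "(\<Sum>l\<in>cube_indices. variation_coeff lam l) = 0" unfolding sum_zeta by simp
  have "(- \<i> * lam * zeta l) * variation_coeff lam l = zeta l ^ 2 * (- \<i> * lam / (3 * (- \<i> * lam)\<^sup>2))" for l
    by (simp add: variation_coeff_def power2_eq_square)
  then have "(\<Sum>l\<in>cube_indices. (- \<i> * lam * zeta l) * variation_coeff lam l)
      = (\<Sum>l\<in>cube_indices. zeta l ^ 2) * (- \<i> * lam / (3 * (- \<i> * lam)\<^sup>2))"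
    by (simp only: sum_distrib_right)
  then show "(\<Sum>l\<in>cube_indices. (- \<i> * lam * zeta l) * variation_coeff lam l) = 0"
    unfolding sum_zeta_square by simp
  have "(- \<i> * lam * zeta l)\<^sup>2 * variation_coeff lam l = zeta l ^ 3 / 3" for l
    using assms by (simp add: variation_coeff_def power2_eq_square power3_eq_cube)
  then have "(\<Sum>l\<in>cube_indices. (- \<i> * lam * zeta l)\<^sup>2 * variation_coeff lam l) = (\<Sum>l\<in>cube_indices. 1 / 3)"
    by (simp only: zeta_cube)
  then show "(\<Sum>l\<in>cube_indices. (- \<i> * lam * zeta l)\<^sup>2 * variation_coeff lam l) = 1" by simp
qed

lemma s2_kernel_eq_modes:
  "s 2 (- \<i> * lam * of_real (x - t)) / (- \<i> * lam)\<^sup>2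
     = (\<Sum>l\<in>cube_indices. variation_coeff lam l * mode lam l x * mode lam l (- t))"
  unfolding s_eq_modes sum_divide_distrib variation_coeff_def
proof (intro sum.cong refl)
  fix l
  have "1 / (3 * zeta l ^ 2) * E1 * E2 / (- \<i> * lam)\<^sup>2 = (1 / zeta l ^ 2) / (3 * (- \<i> * lam)\<^sup>2) * E1 * E2" for E1 E2
    by simp
  then show "1 / (3 * zeta l ^ 2) * mode lam l x * mode lam l (- t) / (- \<i> * lam)\<^sup>2 =
      zeta l / (3 * (- \<i> * lam)\<^sup>2) * mode lam l x * mode lam l (- t)"
    unfolding inverse_zeta_square .
qed

lemma s1_kernel_eq_modes:
  assumes "lam \<noteq> 0"
  shows "s 1 (- \<i> * lam * of_real (x - t)) / (- \<i> * lam)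
     = (\<Sum>l\<in>cube_indices. (- \<i> * lam * zeta l) * variation_coeff lam l * mode lam l x * mode lam l (- t))"
  unfolding s_eq_modes sum_divide_distrib variation_coeff_def
proof (intro sum.cong refl)
  fix l
  have "1 / (3 * zeta l ^ 1) * E1 * E2 / (- \<i> * lam) = (- \<i> * lam * zeta l) * (zeta l / (3 * (- \<i> * lam)\<^sup>2)) * E1 * E2" for E1 E2
    using assms inverse_zeta[of l] zeta_nonzero[of l] by (simp add: field_simps power2_eq_square)
  then show "1 / (3 * zeta l ^ 1) * mode lam l x * mode lam l (- t) / (- \<i> * lam) =
      (- \<i> * lam * zeta l) * (zeta l / (3 * (- \<i> * lam)\<^sup>2)) * mode lam l x * mode lam l (- t)" .
qed

section \<open>Variation of constants\<close>

text \<open>The functions \<open>c l\<close> are the variable amplitudes of the three modes for the forcing term \<open>w\<close>; \<open>d l\<close> are their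
values at \<open>-\<infinity>\<close>.\<close>
locale variation_of_constants =
  fixes lam :: complex and w :: "real \<Rightarrow> complex" and d :: "nat \<Rightarrow> complex" and c :: "nat \<Rightarrow> real \<Rightarrow> complex"
  assumes lam_nonzero: "lam \<noteq> 0"
    and weighted_integrable: "\<And>l. integrable lebesgue (\<lambda>t. mode lam l (- t) * w t)"
    and amplitude_eq: "\<And>l x. l \<in> cube_indices \<Longrightarrow>
      c l x = d l + variation_coeff lam l * integral_upto (\<lambda>t. mode lam l (- t) * w t) x"
begin

text \<open>The candidate for the \<open>n\<close>-th derivative of the solution, formed as if the amplitudes were constant.\<close>
definition superposition :: "nat \<Rightarrow> real \<Rightarrow> complex" where
  "superposition n x = (\<Sum>l\<in>cube_indices. (- \<i> * lam * zeta l) ^ n * mode lam l x * c l x)"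

lemma isCont_amplitude: "l \<in> cube_indices \<Longrightarrow> isCont (c l) x"
proof -
  assume l: "l \<in> cube_indices"
  have "continuous_on UNIV (\<lambda>x. d l + variation_coeff lam l * integral_upto (\<lambda>t. mode lam l (- t) * w t) x)"
    by (intro continuous_intros continuous_integral_upto weighted_integrable)
  then have "continuous_on UNIV (c l)" using amplitude_eq[OF l] by (simp cong: continuous_on_cong)
  then show ?thesis by (simp add: continuous_on_eq_continuous_at)
qed

text \<open>At a point where all amplitudes are differentiable this is the product rule; by Lebesgue's differentiation theorem
almost every point is of this kind.\<close>
lemma superposition_deriv_AE:
  "AE x in lebesgue. (superposition n has_vector_derivative
     superposition (Suc n) x + (\<Sum>l\<in>cube_indices. (- \<i> * lam * zeta l) ^ n * variation_coeff lam l) * w x) (at x)"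
proof -
  have "AE x in lebesgue. \<forall>l\<in>cube_indices.
      (integral_upto (\<lambda>t. mode lam l (- t) * w t) has_vector_derivative mode lam l (- x) * w x) (at x)"
    by (rule AE_finite_allI) (use AE_has_vector_derivative_integral_upto[OF weighted_integrable] in auto)
  then show ?thesis
  proof eventually_elim
    case (elim x)
    let ?z = "\<lambda>l. - \<i> * lam * zeta l"
    have c': "(c l has_vector_derivative variation_coeff lam l * (mode lam l (- x) * w x)) (at x)"
      if l: "l \<in> cube_indices" for l
    proof -
      have "((\<lambda>x. d l + variation_coeff lam l * integral_upto (\<lambda>t. mode lam l (- t) * w t) x) has_vector_derivative
          0 + variation_coeff lam l * (mode lam l (- x) * w x)) (at x)"
        by (intro has_vector_derivative_add has_vector_derivative_const has_vector_derivative_mult_right) (use elim l in auto)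
      then show ?thesis unfolding amplitude_eq[OF l, abs_def] by simp
    qed
    have "(superposition n has_vector_derivative (\<Sum>l\<in>cube_indices.
        ?z l ^ n * mode lam l x * (variation_coeff lam l * (mode lam l (- x) * w x))
          + ?z l ^ n * (?z l * mode lam l x) * c l x)) (at x)"
      unfolding superposition_def[abs_def]
      by (intro has_vector_derivative_sum has_vector_derivative_mult has_vector_derivative_mult_right mode_deriv c')
    also have "(\<Sum>l\<in>cube_indices. ?z l ^ n * mode lam l x * (variation_coeff lam l * (mode lam l (- x) * w x))
          + ?z l ^ n * (?z l * mode lam l x) * c l x)
        = superposition (Suc n) x + (\<Sum>l\<in>cube_indices. ?z l ^ n * variation_coeff lam l) * w x"
      unfolding superposition_def sum_distrib_right sum.distrib[symmetric]
    proof (intro sum.cong refl)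
      fix l
      have "?z l ^ n * mode lam l x * (variation_coeff lam l * (mode lam l (- x) * w x))
          = ?z l ^ n * variation_coeff lam l * w x * (mode lam l x * mode lam l (- x))"
        by (simp only: mult_ac)
      then show "?z l ^ n * mode lam l x * (variation_coeff lam l * (mode lam l (- x) * w x))
          + ?z l ^ n * (?z l * mode lam l x) * c l x
          = ?z l ^ Suc n * mode lam l x * c l x + ?z l ^ n * variation_coeff lam l * w x"
        by (simp add: mult_ac)
    qed
    finally show ?case .
  qed
qed

text \<open>The derivative exists at every point, also where the amplitudes \<open>c l\<close> are not differentiable. Write \<open>I\<^sub>l\<close> for the
integral in \<open>c\<^sub>l\<close> and expand \<open>e\<^sub>l(y) c\<^sub>l(y)\<close> around \<open>x\<close>. Freezing the amplitude gives the expected derivative. The mixed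
term \<open>(e\<^sub>l(y) - e\<^sub>l(x)) (c\<^sub>l(y) - c\<^sub>l(x))\<close> has derivative \<open>0\<close> by continuity of \<open>c\<^sub>l\<close>. Freezing the mode leaves
\<open>\<Sum>\<^sub>l b\<^sub>l e\<^sub>l(x) (I\<^sub>l(y) - I\<^sub>l(x))\<close>, the integral of \<open>w\<close> over \<open>[x, y]\<close> against a smooth kernel that vanishes at
\<open>t = x\<close> by hypothesis.\<close>
lemma superposition_deriv:
  assumes vanish: "(\<Sum>l\<in>cube_indices. (- \<i> * lam * zeta l) ^ n * variation_coeff lam l) = 0"
  shows "(superposition n has_vector_derivative superposition (Suc n) x) (at x)"
proof -
  let ?z = "\<lambda>l. - \<i> * lam * zeta l"
  let ?I = "\<lambda>l. integral_upto (\<lambda>t. mode lam l (- t) * w t)"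
  define b where "b l = ?z l ^ n * variation_coeff lam l" for l
  \<comment> \<open>The integrability hypothesis is on \<open>w\<close> times a mode, so one mode is split off from the kernel and put into \<open>W\<close>.\<close>
  define W where "W t = mode lam 0 (- t) * w t" for t
  define \<psi> where "\<psi> t = (\<Sum>l\<in>cube_indices. b l * (mode lam l x * mode lam l (- t))) * mode lam 0 t" for t
  have \<psi>W: "\<psi> t * W t = (\<Sum>l\<in>cube_indices. b l * mode lam l x * (mode lam l (- t) * w t))" for t
  proof -
    have "\<psi> t * W t = (\<Sum>l\<in>cube_indices. b l * (mode lam l x * mode lam l (- t))) * (w t * (mode lam 0 t * mode lam 0 (- t)))"
      unfolding \<psi>_def W_def by (simp only: mult_ac)
    then show ?thesis unfolding mode_minus mult_1_right sum_distrib_right by (simp only: mult_ac)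
  qed
  have \<psi>W_int: "integrable lebesgue (\<lambda>t. \<psi> t * W t)"
    unfolding \<psi>W by (intro Bochner_Integration.integrable_sum integrable_mult_right weighted_integrable)
  have upto_\<psi>W: "integral_upto (\<lambda>t. \<psi> t * W t) y = (\<Sum>l\<in>cube_indices. b l * mode lam l x * ?I l y)" for y
  proof -
    have "integral_upto (\<lambda>t. \<psi> t * W t) y = (\<Sum>l\<in>cube_indices. integral_upto (\<lambda>t. b l * mode lam l x * (mode lam l (- t) * w t)) y)"
      unfolding \<psi>W
      by (rule set_integral_sum) (intro integrable_imp_set_integrable integrable_mult_right weighted_integrable, simp)
    then show ?thesis by (simp only: set_integral_mult_right)
  qed
  have deriv3: "((\<lambda>y. \<Sum>l\<in>cube_indices. b l * mode lam l x * ?I l y) has_vector_derivative 0) (at x)"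
    unfolding upto_\<psi>W[symmetric]
  proof (rule has_vector_derivative_integral_upto_vanishing[OF _ \<psi>W_int])
    show "integrable lebesgue W" unfolding W_def by (rule weighted_integrable)
    have "\<psi> differentiable at x" unfolding \<psi>_def mode_uminus
      by (auto intro!: derivative_intros mode_differentiable)
    then show "(\<psi> has_vector_derivative vector_derivative \<psi> (at x)) (at x)"
      by (simp add: vector_derivative_works)
    show "\<psi> x = 0" unfolding \<psi>_def mode_minus b_def using vanish by simp
  qed
  have deriv2: "((\<lambda>y. (mode lam l y - mode lam l x) * (c l y - c l x)) has_vector_derivative 0) (at x)"
    if "l \<in> cube_indices" for l
  proof -
    have "((\<lambda>y. (mode lam l y - mode lam l x) * (c l y - c l x)) has_vector_derivative
        (?z l * mode lam l x - 0) * (c l x - c l x)) (at x)"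
      by (intro has_vector_derivative_mult_vanishing has_vector_derivative_diff mode_deriv has_vector_derivative_const
          continuous_intros isCont_amplitude that) simp
    then show ?thesis by simp
  qed
  have decomp: "superposition n y =
      (\<Sum>l\<in>cube_indices. ?z l ^ n * mode lam l y * c l x
         + ?z l ^ n * ((mode lam l y - mode lam l x) * (c l y - c l x)))
      + ((\<Sum>l\<in>cube_indices. b l * mode lam l x * ?I l y) - (\<Sum>l\<in>cube_indices. b l * mode lam l x * ?I l x))" for y
    unfolding superposition_def sum_subtractf[symmetric] sum.distrib[symmetric]
  proof (intro sum.cong refl)
    fix l assume l: "l \<in> cube_indices"
    have "c l y - c l x = variation_coeff lam l * (?I l y - ?I l x)"
      unfolding amplitude_eq[OF l] by (simp add: algebra_simps)
    then have "b l * mode lam l x * ?I l y - b l * mode lam l x * ?I l x = ?z l ^ n * mode lam l x * (c l y - c l x)"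
      unfolding b_def by (simp only: mult.assoc right_diff_distrib[symmetric] mult.left_commute)
    then show "?z l ^ n * mode lam l y * c l y =
        ?z l ^ n * mode lam l y * c l x + ?z l ^ n * ((mode lam l y - mode lam l x) * (c l y - c l x))
        + (b l * mode lam l x * ?I l y - b l * mode lam l x * ?I l x)"
      by (simp only:) (simp only: ring_distribs mult.assoc, simp)
  qed
  have "(superposition n has_vector_derivative
      (\<Sum>l\<in>cube_indices. ?z l ^ n * (?z l * mode lam l x) * c l x + ?z l ^ n * 0) + (0 - 0)) (at x)"
    unfolding decomp[abs_def]
    by (intro has_vector_derivative_add has_vector_derivative_sum has_vector_derivative_diff has_vector_derivative_mult_left
        has_vector_derivative_mult_right mode_deriv deriv2 deriv3 has_vector_derivative_const)
  then show ?thesis by (simp add: superposition_def mult_ac)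
qed

lemma locally_absolutely_continuous_superposition: "locally_absolutely_continuous (superposition n)"
  unfolding locally_absolutely_continuous_def superposition_def[abs_def]
proof (intro allI impI absolutely_continuous_sum absolutely_continuous_mult)
  fix a b :: real and l assume l: "l \<in> cube_indices"
  show "absolutely_continuous_on_interval a b (\<lambda>x. (- \<i> * lam * zeta l) ^ n)"
    by (rule absolutely_continuous_Lipschitz[of _ _ _ 0]) simp
  show "absolutely_continuous_on_interval a b (mode lam l)"
    by (rule absolutely_continuous_C1[OF mode_deriv]) (intro continuous_intros continuous_on_mode)
  have "absolutely_continuous_on_interval a b
      (\<lambda>x. d l + variation_coeff lam l * integral_upto (\<lambda>t. mode lam l (- t) * w t) x)"
    by (intro absolutely_continuous_add absolutely_continuous_mult absolutely_continuous_integral_upto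
        weighted_integrable continuous_integral_upto continuous_on_const absolutely_continuous_Lipschitz[of _ _ _ 0]) simp_all
  then show "absolutely_continuous_on_interval a b (c l)"
    using amplitude_eq[OF l] by (simp add: absolutely_continuous_on_interval_def)
  show "continuous_on {a..b} (c l)"
    using isCont_amplitude[OF l] by (simp add: continuous_at_imp_continuous_on)
qed (auto intro!: continuous_intros continuous_on_mode)

lemma kernel_integral:
  assumes "\<And>t. \<kappa> t = (\<Sum>l\<in>cube_indices. b l * mode lam l x * mode lam l (- t))"
  shows "set_integrable lebesgue {..x} (\<lambda>t. \<kappa> t * w t)"
    and "integral_upto (\<lambda>t. \<kappa> t * w t) x = (\<Sum>l\<in>cube_indices. b l * mode lam l x * integral_upto (\<lambda>t. mode lam l (- t) * w t) x)"
proof -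
  have eq: "\<kappa> t * w t = (\<Sum>l\<in>cube_indices. b l * mode lam l x * (mode lam l (- t) * w t))" for t
    unfolding assms sum_distrib_right by (simp only: mult.assoc)
  have int: "set_integrable lebesgue {..x} (\<lambda>t. b l * mode lam l x * (mode lam l (- t) * w t))" for l
    by (intro integrable_imp_set_integrable integrable_mult_right weighted_integrable) simp
  show "set_integrable lebesgue {..x} (\<lambda>t. \<kappa> t * w t)"
    unfolding eq by (intro integrable_imp_set_integrable Bochner_Integration.integrable_sum integrable_mult_right weighted_integrable) simp
  show "integral_upto (\<lambda>t. \<kappa> t * w t) x = (\<Sum>l\<in>cube_indices. b l * mode lam l x * integral_upto (\<lambda>t. mode lam l (- t) * w t) x)"
    unfolding eq by (subst set_integral_sum[OF int]) (simp only: set_integral_mult_right)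
qed

lemma superposition_representation:
  assumes "\<And>t. \<kappa> t = (\<Sum>l\<in>cube_indices. (- \<i> * lam * zeta l) ^ n * variation_coeff lam l * mode lam l x * mode lam l (- t))"
  shows "superposition n x = (\<Sum>l\<in>cube_indices. (- \<i> * lam * zeta l) ^ n * mode lam l x * d l)
    + integral_upto (\<lambda>t. \<kappa> t * w t) x"
  unfolding kernel_integral(2)[of \<kappa> "\<lambda>l. (- \<i> * lam * zeta l) ^ n * variation_coeff lam l", OF assms]
    superposition_def sum.distrib[symmetric]
proof (intro sum.cong refl)
  fix l assume l: "l \<in> cube_indices"
  show "(- \<i> * lam * zeta l) ^ n * mode lam l x * c l x =
      (- \<i> * lam * zeta l) ^ n * mode lam l x * d l
      + (- \<i> * lam * zeta l) ^ n * variation_coeff lam l * mode lam l x * integral_upto (\<lambda>t. mode lam l (- t) * w t) x"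
    unfolding amplitude_eq[OF l] by (simp only: ring_distribs mult_ac)
qed

end

section \<open>Jost solutions for exponentially decaying potentials\<close>

lemma integrable_exp_minus_abs:
  assumes "c > 0"
  shows "integrable lebesgue (\<lambda>x::real. exp (- c * \<bar>x\<bar>))"
proof -
  let ?f = "\<lambda>x::real. indicat_real {0..} x * exp (- c * x)"
  have f_meas: "?f \<in> borel_measurable borel" by simp
  have "set_integrable lebesgue {0..} (\<lambda>x. exp (- c * x))"
    using integrable_on_exp_minus_to_infinity[OF assms, of 0] by (intro nonnegative_absolutely_integrable_1) auto
  then have "integrable lborel ?f"
    using f_meas by (simp add: set_integrable_def integrable_completion)
  then have "integrable lborel (\<lambda>x. ?f x + ?f (0 + - 1 * x))"
    by (intro Bochner_Integration.integrable_add lborel_integrable_real_affine) auto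
  then have "integrable lborel (\<lambda>x::real. exp (- c * \<bar>x\<bar>))"
    by (rule Bochner_Integration.integrable_bound) (auto simp: indicator_def)
  then show ?thesis by (simp add: integrable_completion)
qed

text \<open>With \<open>X = |f| exp (a|x|)\<close> and \<open>Y = exp ((b - a)|x|)\<close>, both square integrable, \<open>X Y \<le> X\<^sup>2 + Y\<^sup>2\<close>.\<close>
lemma integrable_exp_weight:
  fixes f :: "real \<Rightarrow> real"
  assumes f: "f \<in> borel_measurable lebesgue"
    and sq: "integrable lebesgue (\<lambda>x. \<bar>f x\<bar>\<^sup>2 * exp (2 * a * \<bar>x\<bar>))" and "b < a"
  shows "integrable lebesgue (\<lambda>x. \<bar>f x\<bar> * exp (b * \<bar>x\<bar>))"
proof (rule Bochner_Integration.integrable_bound)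
  have "integrable lebesgue (\<lambda>x::real. exp (- (2 * (a - b)) * \<bar>x\<bar>))"
    by (rule integrable_exp_minus_abs) (use \<open>b < a\<close> in simp)
  then show "integrable lebesgue (\<lambda>x. \<bar>f x\<bar>\<^sup>2 * exp (2 * a * \<bar>x\<bar>) + exp (- (2 * (a - b)) * \<bar>x\<bar>))"
    using sq by simp
  have "(\<lambda>x::real. exp (b * \<bar>x\<bar>)) \<in> borel_measurable lebesgue"
    by (intro measurable_completion) simp
  then show "(\<lambda>x. \<bar>f x\<bar> * exp (b * \<bar>x\<bar>)) \<in> borel_measurable lebesgue"
    using f by simp
  show "AE x in lebesgue. norm (\<bar>f x\<bar> * exp (b * \<bar>x\<bar>))
      \<le> norm (\<bar>f x\<bar>\<^sup>2 * exp (2 * a * \<bar>x\<bar>) + exp (- (2 * (a - b)) * \<bar>x\<bar>))"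
  proof (rule AE_I2)
    fix x :: real
    let ?X = "\<bar>f x\<bar> * exp (a * \<bar>x\<bar>)" and ?Y = "exp ((b - a) * \<bar>x\<bar>)"
    have "?X * ?Y \<le> ?X\<^sup>2 + ?Y\<^sup>2"
    proof -
      have "0 \<le> ?X * ?Y" by simp
      then show ?thesis using sum_squares_bound[of ?X ?Y] by linarith
    qed
    moreover have "?X * ?Y = \<bar>f x\<bar> * exp (b * \<bar>x\<bar>)"
      by (simp add: exp_add[symmetric] algebra_simps)
    moreover have "?X\<^sup>2 = \<bar>f x\<bar>\<^sup>2 * exp (2 * a * \<bar>x\<bar>)"
      by (simp add: power_mult_distrib exp_double[symmetric] mult.assoc)
    moreover have "?Y\<^sup>2 = exp (- (2 * (a - b)) * \<bar>x\<bar>)"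
      by (simp add: exp_double[symmetric] algebra_simps)
    ultimately show "norm (\<bar>f x\<bar> * exp (b * \<bar>x\<bar>))
      \<le> norm (\<bar>f x\<bar>\<^sup>2 * exp (2 * a * \<bar>x\<bar>) + exp (- (2 * (a - b)) * \<bar>x\<bar>))" by simp
  qed
qed


text \<open>The matrix of the linear system for the amplitudes: the forcing term \<open>P u + 2 p u'\<close> written in terms of the
amplitudes, distributed over the modes as in \<open>variation_of_constants\<close>.\<close>
definition amplitude_coeff ::
  "(real \<Rightarrow> real) \<Rightarrow> (real \<Rightarrow> real) \<Rightarrow> complex \<Rightarrow> nat \<Rightarrow> nat \<Rightarrow> real \<Rightarrow> complex" where
  "amplitude_coeff p q lam j l t = variation_coeff lam j * mode lam j (- t) *
     ((of_real (deriv p t) + \<i> * of_real (q t) + 2 * of_real (p t) * (- \<i> * lam * zeta l)) * mode lam l t)"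

definition amplitude ::
  "(real \<Rightarrow> real) \<Rightarrow> (real \<Rightarrow> real) \<Rightarrow> nat \<Rightarrow> complex \<Rightarrow> nat \<Rightarrow> real \<Rightarrow> complex" where
  "amplitude p q k lam l x = dyson_series cube_indices (amplitude_coeff p q lam) (\<lambda>l. if l = k then 1 else 0) l x"

text \<open>The \<open>n\<close>-th derivative of the Jost solution with index \<open>k\<close> for \<open>n \<le> 2\<close>; the solution itself is the case \<open>n = 0\<close>.\<close>
definition jost ::
  "(real \<Rightarrow> real) \<Rightarrow> (real \<Rightarrow> real) \<Rightarrow> nat \<Rightarrow> nat \<Rightarrow> complex \<Rightarrow> real \<Rightarrow> complex" where
  "jost p q n k lam x = (\<Sum>l\<in>cube_indices. (- \<i> * lam * zeta l) ^ n * mode lam l x * amplitude p q k lam l x)"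

text \<open>The function \<open>w = P u + 2 p u'\<close>, which turns out to solve the integral equation.\<close>
definition jost_source ::
  "(real \<Rightarrow> real) \<Rightarrow> (real \<Rightarrow> real) \<Rightarrow> nat \<Rightarrow> complex \<Rightarrow> real \<Rightarrow> complex" where
  "jost_source p q k lam x = (of_real (deriv p x) + \<i> * of_real (q x)) * jost p q 0 k lam x
     + 2 * of_real (p x) * jost p q 1 k lam x"

text \<open>Bounds the row sums of the matrix for all parameters with \<open>\<epsilon> \<le> |lam| \<le> r\<close>; the factor \<open>1 / \<epsilon>\<^sup>2\<close> absorbs the
singularity of \<open>variation_coeff\<close> at \<open>lam = 0\<close>.\<close>
definition majorant :: "(real \<Rightarrow> real) \<Rightarrow> (real \<Rightarrow> real) \<Rightarrow> real \<Rightarrow> real \<Rightarrow> real \<Rightarrow> real" where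
  "majorant p q \<epsilon> r t = (1 + 2 * r) / \<epsilon>\<^sup>2 * ((\<bar>deriv p t\<bar> + \<bar>q t\<bar> + \<bar>p t\<bar>) * exp (2 * r * \<bar>t\<bar>))"

lemma amplitude_coeff_holomorphic:
  assumes "0 \<notin> S"
  shows "(\<lambda>lam. amplitude_coeff p q lam j l t) holomorphic_on S"
  unfolding amplitude_coeff_def variation_coeff_def mode_def
  by (intro holomorphic_intros) (use assms in auto)

locale decaying_potentials =
  fixes a :: real and p q :: "real \<Rightarrow> real"
  assumes p_C1: "p C1_differentiable_on UNIV"
    and q_measurable: "q \<in> borel_measurable lebesgue"
    and q_decay: "integrable lebesgue (\<lambda>x. \<bar>q x\<bar>\<^sup>2 * exp (2 * a * \<bar>x\<bar>))"
    and p_decay: "integrable lebesgue (\<lambda>x. \<bar>p x\<bar>\<^sup>2 * exp (2 * a * \<bar>x\<bar>))"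
    and p'_decay: "integrable lebesgue (\<lambda>x. \<bar>deriv p x\<bar>\<^sup>2 * exp (2 * a * \<bar>x\<bar>))"
begin

lemma p_measurable: "p \<in> borel_measurable lebesgue"
  and p'_measurable: "deriv p \<in> borel_measurable lebesgue"
proof -
  obtain D where D: "\<And>x. (p has_vector_derivative D x) (at x)" "continuous_on UNIV D"
    using p_C1 unfolding C1_differentiable_on_def by auto
  then have "deriv p = D"
    by (intro ext DERIV_imp_deriv) (simp add: has_real_derivative_iff_has_vector_derivative)
  with D(2) show "deriv p \<in> borel_measurable lebesgue"
    by (intro measurable_completion) (simp add: borel_measurable_continuous_onI)
  have "continuous_on UNIV p"
    using D(1) by (intro continuous_at_imp_continuous_on ballI has_vector_derivative_continuous)
  then show "p \<in> borel_measurable lebesgue"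
    by (intro measurable_completion) (simp add: borel_measurable_continuous_onI)
qed

lemma potential_measurable:
  "(\<lambda>t. of_real (deriv p t) + \<i> * of_real (q t) + 2 * of_real (p t) * (- \<i> * lam * zeta l)) \<in> borel_measurable lebesgue"
proof -
  have of_real: "(\<lambda>t. complex_of_real (f t)) \<in> borel_measurable lebesgue"
    if "f \<in> borel_measurable lebesgue" for f :: "real \<Rightarrow> real"
    by (rule measurable_compose[OF that]) simp
  show ?thesis
    by (intro borel_measurable_times borel_measurable_add borel_measurable_const of_real
        p_measurable q_measurable p'_measurable)
qed

lemma majorant_integrable:
  assumes "r < a / 2"
  shows "integrable lebesgue (majorant p q \<epsilon> r)"
proof -
  have r: "2 * r < a" using assms by simp
  have "integrable lebesgue (\<lambda>t. (1 + 2 * r) / \<epsilon>\<^sup>2 * (\<bar>deriv p t\<bar> * exp (2 * r * \<bar>t\<bar>) + \<bar>q t\<bar> * exp (2 * r * \<bar>t\<bar>)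
      + \<bar>p t\<bar> * exp (2 * r * \<bar>t\<bar>)))"
    by (intro integrable_mult_right Bochner_Integration.integrable_add integrable_exp_weight[OF _ _ r]
        p_measurable q_measurable p'_measurable p_decay q_decay p'_decay)
  then show ?thesis by (simp add: majorant_def[abs_def] distrib_right)
qed

lemma norm_potential_le:
  assumes "cmod lam \<le> r"
  shows "cmod (of_real (deriv p t) + \<i> * of_real (q t) + 2 * of_real (p t) * (- \<i> * lam * zeta l))
    \<le> (1 + 2 * r) * (\<bar>deriv p t\<bar> + \<bar>q t\<bar> + \<bar>p t\<bar>)"
proof -
  have r: "0 \<le> r" using assms norm_ge_zero order_trans by blast
  have "cmod (of_real (deriv p t) + \<i> * of_real (q t) + 2 * of_real (p t) * (- \<i> * lam * zeta l))
      \<le> \<bar>deriv p t\<bar> + \<bar>q t\<bar> + 2 * \<bar>p t\<bar> * cmod lam"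
    by (rule order_trans[OF norm_triangle_ineq add_mono[OF order_trans[OF norm_triangle_ineq]]])
       (simp_all add: norm_mult norm_zeta)
  also have "2 * \<bar>p t\<bar> * cmod lam \<le> 2 * \<bar>p t\<bar> * r"
    by (rule mult_left_mono[OF assms]) simp
  also have "\<bar>deriv p t\<bar> + \<bar>q t\<bar> + 2 * \<bar>p t\<bar> * r \<le> (1 + 2 * r) * (\<bar>deriv p t\<bar> + \<bar>q t\<bar> + \<bar>p t\<bar>)"
    using r by (simp add: algebra_simps)
  finally show ?thesis by simp
qed

lemma norm_amplitude_coeff_le:
  assumes "0 < \<epsilon>" "\<epsilon> \<le> cmod lam" "cmod lam \<le> r"
  shows "cmod (amplitude_coeff p q lam j l t) \<le> majorant p q \<epsilon> r t / 3"
proof -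
  let ?m = "\<bar>deriv p t\<bar> + \<bar>q t\<bar> + \<bar>p t\<bar>"
  have r: "0 \<le> r" using assms(3) norm_ge_zero order_trans by blast
  have mode_le: "cmod (mode lam i y) \<le> exp (r * \<bar>t\<bar>)" if "\<bar>y\<bar> = \<bar>t\<bar>" for i y
    using norm_mode_le[of lam i y] that mult_right_mono[OF assms(3), of "\<bar>t\<bar>"] order_trans
    by (metis abs_ge_zero exp_le_cancel_iff)
  have "cmod (variation_coeff lam j) = 1 / (3 * (cmod lam)\<^sup>2)"
    by (simp add: variation_coeff_def norm_divide norm_mult norm_power norm_zeta)
  also have "\<dots> \<le> 1 / (3 * \<epsilon>\<^sup>2)"
    using assms by (intro divide_left_mono mult_left_mono power_mono mult_pos_pos zero_less_power) auto
  finally have "cmod (amplitude_coeff p q lam j l t)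
      \<le> 1 / (3 * \<epsilon>\<^sup>2) * exp (r * \<bar>t\<bar>) * (((1 + 2 * r) * ?m) * exp (r * \<bar>t\<bar>))"
    unfolding amplitude_coeff_def norm_mult[of _ "mode lam l t"] norm_mult[of "variation_coeff lam j * _"]
      norm_mult[of "variation_coeff lam j"]
    by (intro mult_mono norm_potential_le assms mode_le) (use r in auto)
  also have "\<dots> = majorant p q \<epsilon> r t / 3"
  proof -
    have "exp (2 * r * \<bar>t\<bar>) = exp (r * \<bar>t\<bar>) * exp (r * \<bar>t\<bar>)" by (simp add: exp_add[symmetric])
    then show ?thesis by (simp add: majorant_def mult_ac)
  qed
  finally show ?thesis .
qed

lemma amplitude_system:
  assumes "0 < \<epsilon>" "\<epsilon> \<le> cmod lam" "cmod lam \<le> r" "r < a / 2"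
  shows "integrable_system cube_indices (amplitude_coeff p q lam) (\<lambda>l. if l = k then 1 else 0) (majorant p q \<epsilon> r)"
proof
  show "amplitude_coeff p q lam j l \<in> borel_measurable lebesgue" for j l
    unfolding amplitude_coeff_def[abs_def] mode_uminus
    by (intro borel_measurable_times borel_measurable_const potential_measurable mode_measurable)
  show "(\<Sum>l\<in>cube_indices. cmod (amplitude_coeff p q lam j l t)) \<le> majorant p q \<epsilon> r t" for j t
  proof -
    have "(\<Sum>l\<in>cube_indices. cmod (amplitude_coeff p q lam j l t)) \<le> (\<Sum>l\<in>cube_indices. majorant p q \<epsilon> r t / 3)"
      by (intro sum_mono norm_amplitude_coeff_le assms)
    then show ?thesis by simp
  qed
  show "0 \<le> majorant p q \<epsilon> r t" for t
    using order_trans[OF norm_ge_zero norm_amplitude_coeff_le[OF assms(1-3)]] by simp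
  show "integrable lebesgue (majorant p q \<epsilon> r)"
    by (rule majorant_integrable[OF assms(4)])
qed auto

text \<open>Around each point choose an annulus whose closure avoids \<open>0\<close> and the circle of radius \<open>a / 2\<close>: on it a single
integrable majorant is available.\<close>
lemma amplitude_holomorphic:
  assumes "l \<in> cube_indices"
  shows "(\<lambda>lam. amplitude p q k lam l x) holomorphic_on D0 (a / 2)"
proof -
  have "(\<lambda>lam. amplitude p q k lam l x) field_differentiable at z" if z: "z \<in> D0 (a / 2)" for z
  proof -
    define \<epsilon> where "\<epsilon> = cmod z / 2"
    define r where "r = (cmod z + a / 2) / 2"
    define S where "S = - cball 0 \<epsilon> \<inter> ball (0::complex) r"
    have \<epsilon>: "0 < \<epsilon>" and r: "r < a / 2" and zS: "z \<in> S"
      using z by (auto simp: \<epsilon>_def r_def S_def D0_def)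
    have S: "open S" unfolding S_def by (intro open_Int open_Compl closed_cball open_ball)
    have "(\<lambda>lam. amplitude p q k lam l x) holomorphic_on S"
      unfolding amplitude_def
    proof (rule holomorphic_dyson_series[OF S majorant_integrable[OF r, of \<epsilon>] _ _ assms])
      show "integrable_system cube_indices (amplitude_coeff p q lam) (\<lambda>l. if l = k then 1 else 0) (majorant p q \<epsilon> r)"
        if "lam \<in> S" for lam
        using that \<epsilon> r by (intro amplitude_system) (auto simp: S_def)
      show "(\<lambda>lam. amplitude_coeff p q lam j m t) holomorphic_on S" for j m t
        using \<epsilon> by (intro amplitude_coeff_holomorphic) (auto simp: S_def)
    qed
    then show ?thesis using S zS by (simp add: holomorphic_on_imp_differentiable_at)
  qed
  then show ?thesis by (simp add: holomorphic_on_def field_differentiable_at_within)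
qed

lemma open_D0: "open (D0 r)"
proof -
  have "D0 r = ball 0 r - {0}" by (auto simp: D0_def)
  then show ?thesis by (simp add: open_Diff)
qed

lemma jost_holomorphic: "(\<lambda>lam. jost p q n k lam x) holomorphic_on D0 (a / 2)"
  unfolding jost_def mode_def by (intro holomorphic_intros amplitude_holomorphic)

lemma jost_source_holomorphic: "(\<lambda>lam. jost_source p q k lam x) holomorphic_on D0 (a / 2)"
  unfolding jost_source_def by (intro holomorphic_intros jost_holomorphic)

lemma jost_source_eq:
  "jost_source p q k lam x = (\<Sum>l\<in>cube_indices.
     (of_real (deriv p x) + \<i> * of_real (q x) + 2 * of_real (p x) * (- \<i> * lam * zeta l))
       * mode lam l x * amplitude p q k lam l x)"
  unfolding jost_source_def jost_def sum_distrib_left sum.distrib[symmetric]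
  by (intro sum.cong refl) (simp only: power_0 power_one_right ring_distribs mult_ac mult_1_left)

context
  fixes lam :: complex and k :: nat
  assumes lam: "lam \<in> D0 (a / 2)"
begin

lemma lam_bounds: "0 < cmod lam" "cmod lam < a / 2" "lam \<noteq> 0"
  using lam by (auto simp: D0_def)

interpretation integrable_system cube_indices "amplitude_coeff p q lam" "\<lambda>l. if l = k then 1 else 0"
  "majorant p q (cmod lam) (cmod lam)"
  by (rule amplitude_system) (use lam_bounds in auto)

lemma amplitude_integral_equation:
  assumes j: "j \<in> cube_indices"
  shows "amplitude p q k lam j x = (if j = k then 1 else 0)
    + variation_coeff lam j * integral_upto (\<lambda>t. mode lam j (- t) * jost_source p q k lam t) x"
proof -
  have "(\<Sum>l\<in>cube_indices. amplitude_coeff p q lam j l t * amplitude p q k lam l t)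
      = variation_coeff lam j * (mode lam j (- t) * jost_source p q k lam t)" for t
    unfolding jost_source_eq amplitude_coeff_def sum_distrib_left
    by (intro sum.cong refl) (simp only: mult_ac)
  then show ?thesis
    using dyson_series_eq[OF j, of x] unfolding amplitude_def[symmetric] by (simp only: set_integral_mult_right)
qed

lemma jost_source_measurable: "jost_source p q k lam \<in> borel_measurable lebesgue"
proof -
  have "amplitude p q k lam l \<in> borel_measurable lebesgue" if "l \<in> cube_indices" for l
    unfolding amplitude_def[abs_def] by (rule dyson_series_measurable[OF that])
  then show ?thesis
    unfolding jost_source_eq[abs_def]
    by (intro borel_measurable_sum borel_measurable_times potential_measurable mode_measurable)
qed

text \<open>The amplitudes are bounded, so \<open>w\<close> is at most the size of the potentials times \<open>exp (|lam| |t|)\<close>; the additional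
weight brings the exponent to \<open>2 |lam| |t|\<close>, which the majorant covers.\<close>
lemma jost_source_weighted_integrable:
  "integrable lebesgue (\<lambda>t. exp (cmod lam * \<bar>t\<bar>) * cmod (jost_source p q k lam t))"
proof -
  let ?\<mu> = "cmod lam"
  define D where "D = (\<Sum>n. integral\<^sup>L lebesgue (majorant p q ?\<mu> ?\<mu>) ^ n / fact n)"
  have amp_le: "cmod (amplitude p q k lam l t) \<le> D" if "l \<in> cube_indices" for l t
    unfolding amplitude_def D_def by (rule dyson_series_le[OF that])
  show ?thesis
  proof (rule Bochner_Integration.integrable_bound[OF integrable_mult_right[OF M_integrable, of "3 * D * ?\<mu>\<^sup>2"]])
    show "(\<lambda>t. exp (?\<mu> * \<bar>t\<bar>) * cmod (jost_source p q k lam t)) \<in> borel_measurable lebesgue"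
      using jost_source_measurable
      by (intro borel_measurable_times borel_measurable_norm) (auto intro!: measurable_completion)
    show "AE t in lebesgue. norm (exp (?\<mu> * \<bar>t\<bar>) * cmod (jost_source p q k lam t))
        \<le> norm (3 * D * ?\<mu>\<^sup>2 * majorant p q ?\<mu> ?\<mu> t)"
    proof (rule AE_I2)
      fix t :: real
      let ?m = "\<bar>deriv p t\<bar> + \<bar>q t\<bar> + \<bar>p t\<bar>"
      have "cmod (jost_source p q k lam t) \<le> (\<Sum>l\<in>cube_indices. (1 + 2 * ?\<mu>) * ?m * exp (?\<mu> * \<bar>t\<bar>) * D)"
        unfolding jost_source_eq
      proof (rule order_trans[OF norm_sum sum_mono])
        fix l assume l: "l \<in> cube_indices"
        show "cmod ((of_real (deriv p t) + \<i> * of_real (q t) + 2 * of_real (p t) * (- \<i> * lam * zeta l))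
            * mode lam l t * amplitude p q k lam l t) \<le> (1 + 2 * ?\<mu>) * ?m * exp (?\<mu> * \<bar>t\<bar>) * D"
          unfolding norm_mult[of _ "amplitude p q k lam l t"] norm_mult[of _ "mode lam l t"]
          by (intro mult_mono norm_potential_le norm_mode_le amp_le l) auto
      qed
      also have "\<dots> = 3 * ((1 + 2 * ?\<mu>) * ?m * exp (?\<mu> * \<bar>t\<bar>) * D)" by simp
      finally have "exp (?\<mu> * \<bar>t\<bar>) * cmod (jost_source p q k lam t)
          \<le> exp (?\<mu> * \<bar>t\<bar>) * (3 * ((1 + 2 * ?\<mu>) * ?m * exp (?\<mu> * \<bar>t\<bar>) * D))"
        by (rule mult_left_mono) simp
      also have "\<dots> = 3 * D * ?\<mu>\<^sup>2 * majorant p q ?\<mu> ?\<mu> t"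
      proof -
        have "exp (2 * ?\<mu> * \<bar>t\<bar>) = exp (?\<mu> * \<bar>t\<bar>) * exp (?\<mu> * \<bar>t\<bar>)" by (simp add: exp_add[symmetric])
        then show ?thesis using lam_bounds by (simp add: majorant_def)
      qed
      finally show "norm (exp (?\<mu> * \<bar>t\<bar>) * cmod (jost_source p q k lam t))
          \<le> norm (3 * D * ?\<mu>\<^sup>2 * majorant p q ?\<mu> ?\<mu> t)" by simp
    qed
  qed
qed

interpretation variation_of_constants lam "jost_source p q k lam" "\<lambda>l. if l = k then 1 else 0" "amplitude p q k lam"
proof
  show "lam \<noteq> 0" by (rule lam_bounds)
  show "integrable lebesgue (\<lambda>t. mode lam l (- t) * jost_source p q k lam t)" for l
  proof (rule Bochner_Integration.integrable_bound[OF jost_source_weighted_integrable])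
    show "(\<lambda>t. mode lam l (- t) * jost_source p q k lam t) \<in> borel_measurable lebesgue"
      unfolding mode_uminus by (intro borel_measurable_times mode_measurable jost_source_measurable)
    show "AE t in lebesgue. norm (mode lam l (- t) * jost_source p q k lam t)
        \<le> norm (exp (cmod lam * \<bar>t\<bar>) * cmod (jost_source p q k lam t))"
      using norm_mode_le[of lam l "- t" for t] by (auto intro!: AE_I2 mult_right_mono simp: norm_mult)
  qed
qed (rule amplitude_integral_equation)

lemma jost_eq_superposition: "jost p q n k lam = superposition n"
  by (simp add: fun_eq_iff jost_def superposition_def)

text \<open>Since \<open>(z \<zeta>\<^sub>l)\<^sup>3 = z\<^sup>3 = \<i> lam\<^sup>3\<close> for every mode, the formal third derivative is \<open>\<i> lam\<^sup>3 u\<close>; the almost everywhere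
derivative of \<open>u''\<close> adds the forcing term \<open>w\<close>.\<close>
lemma jost_is_solution: "is_solution p q lam (jost p q 0 k lam)"
  unfolding is_solution_def
proof (rule exI[of _ "jost p q 1 k lam"], rule exI[of _ "jost p q 2 k lam"], intro conjI allI)
  show "(jost p q 0 k lam has_vector_derivative jost p q 1 k lam x) (at x)" for x
    using superposition_deriv[of 0 x] sum_variation_coeff(1)[OF lam_bounds(3)]
    by (simp add: jost_eq_superposition)
  show "(jost p q 1 k lam has_vector_derivative jost p q 2 k lam x) (at x)" for x
    using superposition_deriv[of 1 x] sum_variation_coeff(2)[OF lam_bounds(3)]
    by (simp add: jost_eq_superposition numeral_2_eq_2)
  show "locally_absolutely_continuous (jost p q 2 k lam)"
    unfolding jost_eq_superposition by (rule locally_absolutely_continuous_superposition)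
  have cube: "(- \<i> * lam * zeta l) ^ 3 = \<i> * lam ^ 3" for l
    by (simp only: power_mult_distrib zeta_cube) (simp add: power3_eq_cube)
  have third: "jost p q 3 k lam x = \<i> * lam ^ 3 * jost p q 0 k lam x" for x
    unfolding jost_def cube sum_distrib_left by (simp only: power_0 mult_1_left mult.assoc)
  show "AE x in lebesgue. (jost p q 2 k lam has_vector_derivative
      \<i> * lam ^ 3 * jost p q 0 k lam x + 2 * of_real (p x) * jost p q 1 k lam x
        + (of_real (deriv p x) + \<i> * of_real (q x)) * jost p q 0 k lam x) (at x)"
    using superposition_deriv_AE[of 2]
  proof eventually_elim
    case (elim x)
    then have "(jost p q 2 k lam has_vector_derivative jost p q 3 k lam x + jost_source p q k lam x) (at x)"
      unfolding sum_variation_coeff(3)[OF lam_bounds(3)] jost_eq_superposition by (simp add: numeral_3_eq_3)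
    then show ?case unfolding third jost_source_def by (simp only: add_ac)
  qed
qed

text \<open>The mode may grow as \<open>x\<close> tends to \<open>-\<infinity>\<close>, so it has to be moved under the integral: for \<open>t \<le> x \<le> 0\<close> one has
\<open>|x - t| \<le> |t|\<close>, hence \<open>|e\<^sub>l(x) e\<^sub>l(-t)| \<le> exp (|lam| |t|)\<close>, and the weighted integrability of \<open>w\<close> applies.\<close>
lemma mode_times_integral_tendsto_0:
  "((\<lambda>x. mode lam l x * integral_upto (\<lambda>t. mode lam l (- t) * jost_source p q k lam t) x) \<longlongrightarrow> 0) at_bot"
proof (rule Lim_null_comparison[OF _ integral_upto_tendsto_0[OF jost_source_weighted_integrable]])
  show "\<forall>\<^sub>F x in at_bot. norm (mode lam l x * integral_upto (\<lambda>t. mode lam l (- t) * jost_source p q k lam t) x)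
      \<le> integral_upto (\<lambda>t. exp (cmod lam * \<bar>t\<bar>) * cmod (jost_source p q k lam t)) x"
    using eventually_le_at_bot[of "0::real"]
  proof eventually_elim
    case (elim x)
    let ?f = "\<lambda>t. mode lam l x * (mode lam l (- t) * jost_source p q k lam t)"
    have int: "set_integrable lebesgue {..x} ?f"
      by (rule integrable_imp_set_integrable) (auto intro!: integrable_mult_right weighted_integrable simp del: integrable_mult_right_iff)
    have "norm (mode lam l x * integral_upto (\<lambda>t. mode lam l (- t) * jost_source p q k lam t) x)
        = norm (integral_upto ?f x)" by (simp only: set_integral_mult_right)
    also have "\<dots> \<le> integral_upto (\<lambda>t. norm (?f t)) x"
      by (rule set_integral_norm_bound[OF int])
    also have "\<dots> \<le> integral_upto (\<lambda>t. exp (cmod lam * \<bar>t\<bar>) * cmod (jost_source p q k lam t)) x"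
    proof (rule set_integral_mono)
      show "set_integrable lebesgue {..x} (\<lambda>t. norm (?f t))"
        by (rule set_integrable_norm[OF int])
      show "set_integrable lebesgue {..x} (\<lambda>t. exp (cmod lam * \<bar>t\<bar>) * cmod (jost_source p q k lam t))"
        by (rule integrable_imp_set_integrable[OF jost_source_weighted_integrable]) simp
      fix t assume "t \<in> {..x}"
      with elim have "\<bar>x - t\<bar> \<le> \<bar>t\<bar>" by simp
      then have "exp (cmod lam * \<bar>x - t\<bar>) \<le> exp (cmod lam * \<bar>t\<bar>)"
        by (simp add: mult_left_mono)
      then have "cmod (mode lam l (x - t)) \<le> exp (cmod lam * \<bar>t\<bar>)"
        using norm_mode_le order_trans by blast
      moreover have "norm (?f t) = cmod (mode lam l (x - t)) * cmod (jost_source p q k lam t)"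
        by (simp only: mode_diff norm_mult mult.assoc)
      ultimately show "norm (?f t) \<le> exp (cmod lam * \<bar>t\<bar>) * cmod (jost_source p q k lam t)"
        by (simp add: mult_right_mono)
    qed
    finally show ?case .
  qed
qed

lemma sum_initial_modes:
  assumes "k \<in> cube_indices"
  shows "(\<Sum>l\<in>cube_indices. (- \<i> * lam * zeta l) ^ n * mode lam l x * (if l = k then 1 else 0))
    = (- \<i> * lam * zeta k) ^ n * mode lam k x"
proof -
  have "(\<Sum>l\<in>cube_indices. (- \<i> * lam * zeta l) ^ n * mode lam l x * (if l = k then 1 else 0))
      = (\<Sum>l\<in>cube_indices. if l = k then (- \<i> * lam * zeta l) ^ n * mode lam l x else 0)"
    by (intro sum.cong refl) simp
  also have "\<dots> = (- \<i> * lam * zeta k) ^ n * mode lam k x"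
    by (subst sum.delta) (use assms in auto)
  finally show ?thesis .
qed

lemma jost_asymptotics:
  assumes k: "k \<in> cube_indices"
  shows "((\<lambda>x. jost p q 0 k lam x - exp (- \<i> * lam * zeta k * of_real x)) \<longlongrightarrow> 0) at_bot"
proof -
  let ?I = "\<lambda>l. integral_upto (\<lambda>t. mode lam l (- t) * jost_source p q k lam t)"
  have eq: "jost p q 0 k lam x - exp (- \<i> * lam * zeta k * of_real x)
      = (\<Sum>l\<in>cube_indices. variation_coeff lam l * (mode lam l x * ?I l x))" for x
  proof -
    have "jost p q 0 k lam x = (\<Sum>l\<in>cube_indices. (- \<i> * lam * zeta l) ^ 0 * mode lam l x * (if l = k then 1 else 0)
        + variation_coeff lam l * (mode lam l x * ?I l x))"
      unfolding jost_def
    proof (intro sum.cong refl)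
      fix l assume "l \<in> cube_indices"
      show "(- \<i> * lam * zeta l) ^ 0 * mode lam l x * amplitude p q k lam l x
          = (- \<i> * lam * zeta l) ^ 0 * mode lam l x * (if l = k then 1 else 0)
            + variation_coeff lam l * (mode lam l x * ?I l x)"
        unfolding amplitude_integral_equation[OF \<open>l \<in> cube_indices\<close>]
        by (simp only: power_0 mult_1_left ring_distribs mult_ac)
    qed
    then show ?thesis
      unfolding sum.distrib sum_initial_modes[OF k] by (simp add: mode_def)
  qed
  have "((\<lambda>x. \<Sum>l\<in>cube_indices. variation_coeff lam l * (mode lam l x * ?I l x))
      \<longlongrightarrow> (\<Sum>l\<in>cube_indices. variation_coeff lam l * 0)) at_bot"
    by (intro tendsto_sum tendsto_mult_left mode_times_integral_tendsto_0)
  then show ?thesis unfolding eq by simp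
qed

lemma jost_is_given_by:
  assumes k: "k \<in> cube_indices"
  shows "is_given_by k lam (jost_source p q k lam) (jost p q 0 k lam)"
  unfolding is_given_by_def
proof (intro allI conjI)
  fix x :: real
  let ?\<kappa> = "\<lambda>t. s 2 (- \<i> * lam * of_real (x - t)) / (- \<i> * lam)\<^sup>2"
  have \<kappa>: "?\<kappa> t = (\<Sum>l\<in>cube_indices. (- \<i> * lam * zeta l) ^ 0 * variation_coeff lam l * mode lam l x * mode lam l (- t))" for t
    unfolding s2_kernel_eq_modes power_0 mult_1_left ..
  show "set_integrable lebesgue {..x} (\<lambda>t. ?\<kappa> t * jost_source p q k lam t)"
    by (rule kernel_integral(1)[OF s2_kernel_eq_modes])
  show "jost p q 0 k lam x = exp (- \<i> * lam * zeta k * of_real x)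
      + integral_upto (\<lambda>t. ?\<kappa> t * jost_source p q k lam t) x"
    unfolding jost_eq_superposition superposition_representation[of ?\<kappa> 0, OF \<kappa>] sum_initial_modes[OF k]
    by (simp add: mode_def)
qed

text \<open>The kernel \<open>K1\<close> combines the kernels that represent \<open>u\<close> and \<open>u'\<close> in the same way as \<open>w\<close> combines \<open>u\<close> and \<open>u'\<close>.\<close>
lemma jost_source_solves_integral_equation:
  assumes k: "k \<in> cube_indices"
  shows "solves_integral_equation p q k lam (jost_source p q k lam)"
  unfolding solves_integral_equation_def
proof (intro allI conjI)
  fix x :: real
  let ?w = "jost_source p q k lam"
  let ?P = "of_real (deriv p x) + \<i> * of_real (q x) :: complex"
  let ?\<kappa>2 = "\<lambda>t. s 2 (- \<i> * lam * of_real (x - t)) / (- \<i> * lam)\<^sup>2"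
  let ?\<kappa>1 = "\<lambda>t. s 1 (- \<i> * lam * of_real (x - t)) / (- \<i> * lam)"
  have \<kappa>1: "?\<kappa>1 t = (\<Sum>l\<in>cube_indices. (- \<i> * lam * zeta l) ^ 1 * variation_coeff lam l * mode lam l x * mode lam l (- t))" for t
    unfolding s1_kernel_eq_modes[OF lam_bounds(3)] power_one_right ..
  have int2: "set_integrable lebesgue {..x} (\<lambda>t. ?P * (?\<kappa>2 t * ?w t))"
    by (rule set_integrable_mult_right) (rule kernel_integral(1)[OF s2_kernel_eq_modes])
  have int1: "set_integrable lebesgue {..x} (\<lambda>t. 2 * of_real (p x) * (?\<kappa>1 t * ?w t))"
    by (rule set_integrable_mult_right) (rule kernel_integral(1)[OF \<kappa>1])
  have K1: "K1 p q lam x t * ?w t = ?P * (?\<kappa>2 t * ?w t) + 2 * of_real (p x) * (?\<kappa>1 t * ?w t)" for t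
    unfolding K1_def by (simp only: ring_distribs mult_ac)
  show "set_integrable lebesgue {..x} (\<lambda>t. K1 p q lam x t * ?w t)"
    unfolding K1 by (rule set_integral_add(1)[OF int2 int1])
  have "integral_upto (\<lambda>t. K1 p q lam x t * ?w t) x
      = ?P * integral_upto (\<lambda>t. ?\<kappa>2 t * ?w t) x + 2 * of_real (p x) * integral_upto (\<lambda>t. ?\<kappa>1 t * ?w t) x"
    unfolding K1 set_integral_add(2)[OF int2 int1] by (simp only: set_integral_mult_right)
  moreover have "jost p q 0 k lam x = mode lam k x + integral_upto (\<lambda>t. ?\<kappa>2 t * ?w t) x"
    using jost_is_given_by[OF k] unfolding is_given_by_def mode_def by blast
  moreover have "jost p q 1 k lam x = - \<i> * lam * zeta k * mode lam k x + integral_upto (\<lambda>t. ?\<kappa>1 t * ?w t) x"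
    unfolding jost_eq_superposition superposition_representation[of ?\<kappa>1 1, OF \<kappa>1] sum_initial_modes[OF k]
    by simp
  moreover have "g p q k lam x = ?P * mode lam k x + 2 * of_real (p x) * (- \<i> * lam * zeta k * mode lam k x)"
    unfolding g_def mode_def by (simp add: algebra_simps)
  ultimately show "?w x = g p q k lam x + integral_upto (\<lambda>t. K1 p q lam x t * ?w t) x"
    unfolding jost_source_def[of p q k lam x] by (simp only: ring_distribs add_ac)
qed

end

end

theorem theorem1p2:
  fixes a :: real and p q :: "real \<Rightarrow> real"
  assumes "a > 0"
    and "p C1_differentiable_on UNIV"
    and "q \<in> borel_measurable lebesgue"
    and "integrable lebesgue (\<lambda>x. \<bar>q x\<bar>\<^sup>2 * exp (2 * a * \<bar>x\<bar>))"
    and "integrable lebesgue (\<lambda>x. \<bar>p x\<bar>\<^sup>2 * exp (2 * a * \<bar>x\<bar>))"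
    and "integrable lebesgue (\<lambda>x. \<bar>deriv p x\<bar>\<^sup>2 * exp (2 * a * \<bar>x\<bar>))"
  shows "\<exists>(u :: nat \<Rightarrow> complex \<Rightarrow> real \<Rightarrow> complex) (w :: nat \<Rightarrow> complex \<Rightarrow> real \<Rightarrow> complex).
    \<forall>k\<in>{0, 1, 2}.
      (\<forall>lam\<in>D0 (a / 2).
         is_Jost_solution_at_bot p q k lam (u k lam) \<and>
         is_given_by k lam (w k lam) (u k lam) \<and>
         solves_integral_equation p q k lam (w k lam)) \<and>
      (\<forall>x. (\<lambda>lam. u k lam x) analytic_on D0 (a / 2) \<and>
           (\<lambda>lam. w k lam x) analytic_on D0 (a / 2))"
proof -
  interpret decaying_potentials a p q
    by unfold_locales (fact assms)+
  show ?thesis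
  proof (rule exI[of _ "jost p q 0"], rule exI[of _ "jost_source p q"], intro ballI conjI allI)
    fix k :: nat and lam assume k: "k \<in> {0, 1, 2}" and lam: "lam \<in> D0 (a / 2)"
    show "is_Jost_solution_at_bot p q k lam (jost p q 0 k lam)"
      unfolding is_Jost_solution_at_bot_def
      using jost_is_solution[OF lam] jost_asymptotics[OF lam k] by blast
    show "is_given_by k lam (jost_source p q k lam) (jost p q 0 k lam)"
      by (rule jost_is_given_by[OF lam k])
    show "solves_integral_equation p q k lam (jost_source p q k lam)"
      by (rule jost_source_solves_integral_equation[OF lam k])
  qed (simp_all add: analytic_on_open open_D0 jost_holomorphic jost_source_holomorphic)
qed

end
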